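(* Let $p$ be an odd prime and $\alpha\geqslant 1$ an integer, and let $X\subseteq\mathbb{Z}_{p^\alpha}\setminus\{0\}$. Then the dihedrant $Dih(p^\alpha,X,X)$ is a (genuine) directed strongly regular graph if and only if $X=\psi_{\gamma}^{-1}(H)$ for some $1\leqslant\gamma\leqslant\alpha$ and some subset $H\subseteq\mathbb{Z}_{p^\gamma}$ satisfying: (i) $H\cup(-H)=\mathbb{Z}_{p^\gamma}\setminus\{0\}$; (ii) $H\cap(-H)=\emptyset$.
   Context: For a positive integer $n$, $D_n=\langle x,a\mid x^n=1,\ a^2=1,\ ax=x^{-1}a\rangle$ is the dihedral group of order $2n$. For $X,Y\subseteq\mathbb{Z}_n$ with $0\notin X$, $Dih(n,X,Y)$ denotes the Cayley digraph $\mathbf{Cay}(D_n,S)$ with $S=\{x^i:i\in X\}\cup\{x^ja:j\in Y\}$: its vertex set is $D_n$ and $g\to h$ is an arc iff $g^{-1}h\in S$. A directed strongly regular graph (DSRG) with parameters $(n,k,\mu,\lambda,t)$ is a digraph on $n$ vertices whose adjacency matrix $A$ satisfies $AJ=JA=kJ$ and $A^2=tI+\lambda A+\mu(J-I-A)$ ($J$ the all-ones matrix); throughout, DSRGs are required to be genuine, i.e. $0<t<k$. For $1\leqslant\gamma\leqslant\alpha$, $\psi_\gamma:\mathbb{Z}_{p^\alpha}\to\mathbb{Z}_{p^\gamma}$ is the reduction-mod-$p^\gamma$ homomorphism (kernel $p^\gamma\mathbb{Z}_{p^\alpha}$), and $\psi_\gamma^{-1}(H)$ is the full preimage of $H$.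 *)

theory Defs
  imports
    "HOL-Algebra.Generated_Groups"
    "HOL-Number_Theory.Residues"
    "Graph_Theory.Digraph"
    "Jordan_Normal_Form.Matrix"
begin

text \<open>
  The dihedral group of order \<open>2n\<close> (for \<open>n > 0\<close>), in normal form: the pair \<open>(i, s)\<close> stands for
  \<open>x\<^sup>i a\<^sup>s\<close>, where \<open>i\<close> is a residue modulo \<open>n\<close> and \<open>s\<close> tells whether the factor \<open>a\<close> occurs.
  The multiplication is forced by \<open>a x\<^sup>j = x\<^bsup>-j\<^esup> a\<close>. The lemmas below show that this is a group
  of order \<open>2n\<close> generated by \<open>x\<close> and \<open>a\<close> subject to the relations of the presentation; as these
  relations bound the order by \<open>2n\<close>, it is the presented group.
\<close>

definition dihedral_group :: "nat \<Rightarrow> (int \<times> bool) monoid" where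
  "dihedral_group n =
     \<lparr>carrier = carrier (residue_ring (int n)) \<times> UNIV,
      monoid.mult = (\<lambda>(i, s) (j, t). ((if s then i - j else i + j) mod int n, s \<noteq> t)),
      one = (0, False)\<rparr>"

definition dih_x :: "nat \<Rightarrow> int \<times> bool" where
  "dih_x n = (1 mod int n, False)"

definition dih_a :: "nat \<Rightarrow> int \<times> bool" where
  "dih_a n = (0, True)"

definition cayley_digraph ::
    "('a, 'b) monoid_scheme \<Rightarrow> 'a set \<Rightarrow> ('a, 'a \<times> 'a) pre_digraph" where
  "cayley_digraph G S =
     \<lparr>verts = carrier G,
      arcs = {(g, h). g \<in> carrier G \<and> h \<in> carrier G \<and> inv\<^bsub>G\<^esub> g \<otimes>\<^bsub>G\<^esub> h \<in> S},
      tail = fst, head = snd\<rparr>"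

definition Dih :: "nat \<Rightarrow> int set \<Rightarrow> int set \<Rightarrow> (int \<times> bool, (int \<times> bool) \<times> (int \<times> bool)) pre_digraph" where
  "Dih n X Y = cayley_digraph (dihedral_group n)
     ({dih_x n [^]\<^bsub>dihedral_group n\<^esub> i | i. i \<in> X} \<union>
      {dih_x n [^]\<^bsub>dihedral_group n\<^esub> j \<otimes>\<^bsub>dihedral_group n\<^esub> dih_a n | j. j \<in> Y})"

text \<open>The rows and columns of the adjacency matrix are indexed by an enumeration \<open>vs\<close> of the vertices.\<close>

definition adjacency_mat :: "('a, 'b) pre_digraph \<Rightarrow> 'a list \<Rightarrow> int mat" where
  "adjacency_mat G vs =
     mat (length vs) (length vs) (\<lambda>(i, j). if vs ! i \<rightarrow>\<^bsub>G\<^esub> vs ! j then 1 else 0)"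

definition all_ones_mat :: "nat \<Rightarrow> int mat" where
  "all_ones_mat n = mat n n (\<lambda>_. 1)"

text \<open>
  The choice of the enumeration is immaterial: another one conjugates the matrices by a permutation
  matrix, which preserves the equations.
\<close>

definition is_dsrg :: "('a, 'b) pre_digraph \<Rightarrow> nat \<Rightarrow> nat \<Rightarrow> nat \<Rightarrow> nat \<Rightarrow> nat \<Rightarrow> bool" where
  "is_dsrg G n k \<mu> lam t \<longleftrightarrow>
     digraph G \<and> card (verts G) = n \<and>
     (\<exists>vs. distinct vs \<and> set vs = verts G \<and>
       (let A = adjacency_mat G vs; J = all_ones_mat n; I = 1\<^sub>m n in
         A * J = int k \<cdot>\<^sub>m J \<and> J * A = int k \<cdot>\<^sub>m J \<and>
         A ^\<^sub>m 2 = int t \<cdot>\<^sub>m I + int lam \<cdot>\<^sub>m A + int \<mu> \<cdot>\<^sub>m (J - I - A)))"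

definition genuine_dsrg :: "('a, 'b) pre_digraph \<Rightarrow> bool" where
  "genuine_dsrg G \<longleftrightarrow> (\<exists>n k \<mu> lam t. is_dsrg G n k \<mu> lam t \<and> 0 < t \<and> t < k)"

text \<open>Reduction modulo \<open>p\<^sup>\<gamma>\<close>, on residues represented by their least non-negative representatives.\<close>

definition psi :: "nat \<Rightarrow> nat \<Rightarrow> int \<Rightarrow> int" where
  "psi p \<gamma> i = i mod int (p ^ \<gamma>)"

definition psi_preimage :: "nat \<Rightarrow> nat \<Rightarrow> nat \<Rightarrow> int set \<Rightarrow> int set" where
  "psi_preimage p \<alpha> \<gamma> H = {i \<in> carrier (residue_ring (int (p ^ \<alpha>))). psi p \<gamma> i \<in> H}"

definition neg_set :: "nat \<Rightarrow> int set \<Rightarrow> int set" where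
  "neg_set m H = {\<ominus>\<^bsub>residue_ring (int m)\<^esub> h | h. h \<in> H}"


lemma dihedral_group_carrier: "carrier (dihedral_group n) = {0..<int n} \<times> UNIV"
  by (auto simp: dihedral_group_def residue_ring_def)

lemma dihedral_group_mult:
  "(i, s) \<otimes>\<^bsub>dihedral_group n\<^esub> (j, t) = ((if s then i - j else i + j) mod int n, s \<noteq> t)"
  by (simp add: dihedral_group_def)

lemma dihedral_group_one: "\<one>\<^bsub>dihedral_group n\<^esub> = (0, False)"
  by (simp add: dihedral_group_def)

lemma group_dihedral_group:
  assumes "n > 0"
  shows "group (dihedral_group n)"
proof (rule groupI)
  fix u assume u: "u \<in> carrier (dihedral_group n)"
  obtain i s where us: "u = (i, s)" by (cases u)
  show "\<exists>v\<in>carrier (dihedral_group n). v \<otimes>\<^bsub>dihedral_group n\<^esub> u = \<one>\<^bsub>dihedral_group n\<^esub>"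
    by (rule bexI[where x = "(if s then i else (- i) mod int n, s)"])
       (use u us assms in \<open>auto simp: dihedral_group_carrier dihedral_group_mult
          dihedral_group_one mod_simps\<close>)
next
  fix u v w :: "int \<times> bool"
  obtain i s j t k r where "u = (i, s)" "v = (j, t)" "w = (k, r)"
    by (metis surj_pair)
  then show "u \<otimes>\<^bsub>dihedral_group n\<^esub> v \<otimes>\<^bsub>dihedral_group n\<^esub> w
      = u \<otimes>\<^bsub>dihedral_group n\<^esub> (v \<otimes>\<^bsub>dihedral_group n\<^esub> w)"
    by (cases s; cases t)
       (simp_all add: dihedral_group_mult mod_simps add_diff_eq diff_add_eq diff_diff_eq2 add.assoc
          flip: diff_diff_eq)
qed (use assms in \<open>auto simp: dihedral_group_carrier dihedral_group_mult dihedral_group_one\<close>)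

lemma order_dihedral_group: "order (dihedral_group n) = 2 * n"
  by (simp add: order_def dihedral_group_def residue_ring_def card_cartesian_product)

lemma dih_x_closed: "n > 0 \<Longrightarrow> dih_x n \<in> carrier (dihedral_group n)"
  by (simp add: dih_x_def dihedral_group_carrier)

lemma dih_a_closed: "n > 0 \<Longrightarrow> dih_a n \<in> carrier (dihedral_group n)"
  by (simp add: dih_a_def dihedral_group_carrier)

lemma dih_x_nat_pow: "dih_x n [^]\<^bsub>dihedral_group n\<^esub> (m :: nat) = (int m mod int n, False)"
proof (induction m)
  case 0
  show ?case by (simp add: dihedral_group_def nat_pow_def)
next
  case (Suc m)
  have "dih_x n [^]\<^bsub>dihedral_group n\<^esub> Suc m
      = dih_x n [^]\<^bsub>dihedral_group n\<^esub> m \<otimes>\<^bsub>dihedral_group n\<^esub> dih_x n"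
    by (simp add: nat_pow_def)
  then show ?case
    using Suc by (simp add: dihedral_group_mult dih_x_def mod_simps add.commute)
qed

lemma dih_x_int_pow:
  assumes "n > 0"
  shows "dih_x n [^]\<^bsub>dihedral_group n\<^esub> (i :: int) = (i mod int n, False)"
proof (cases i rule: int_cases2)
  case (nonneg m)
  then show ?thesis by (simp add: int_pow_int dih_x_nat_pow)
next
  case (nonpos m)
  interpret group "dihedral_group n" by (rule group_dihedral_group[OF assms])
  have "inv\<^bsub>dihedral_group n\<^esub> (dih_x n [^]\<^bsub>dihedral_group n\<^esub> m) = (- int m mod int n, False)"
    by (rule inv_equality)
       (use assms in \<open>simp_all add: dih_x_nat_pow dihedral_group_carrier dihedral_group_mult
          dihedral_group_one mod_add_eq\<close>)
  with nonpos show ?thesis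
    by (simp add: int_pow_neg_int dih_x_closed[OF assms])
qed

lemma dihedral_relations:
  assumes "n > 0"
  shows "dih_x n [^]\<^bsub>dihedral_group n\<^esub> n = \<one>\<^bsub>dihedral_group n\<^esub>"
    and "dih_a n [^]\<^bsub>dihedral_group n\<^esub> (2 :: nat) = \<one>\<^bsub>dihedral_group n\<^esub>"
    and "dih_a n \<otimes>\<^bsub>dihedral_group n\<^esub> dih_x n
         = inv\<^bsub>dihedral_group n\<^esub> dih_x n \<otimes>\<^bsub>dihedral_group n\<^esub> dih_a n"
proof -
  interpret group "dihedral_group n" by (rule group_dihedral_group[OF assms])
  show "dih_x n [^]\<^bsub>dihedral_group n\<^esub> n = \<one>\<^bsub>dihedral_group n\<^esub>"
    by (simp add: dih_x_nat_pow) (simp add: dihedral_group_def)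
  show "dih_a n [^]\<^bsub>dihedral_group n\<^esub> (2 :: nat) = \<one>\<^bsub>dihedral_group n\<^esub>"
    by (simp add: dihedral_group_def dih_a_def nat_pow_def numeral_2_eq_2)
  have "inv\<^bsub>dihedral_group n\<^esub> dih_x n = dih_x n [^]\<^bsub>dihedral_group n\<^esub> (- 1 :: int)"
    using dih_x_closed[OF assms] by (simp add: int_pow_neg)
  also have "\<dots> = ((- 1) mod int n, False)"
    by (rule dih_x_int_pow[OF assms])
  finally show "dih_a n \<otimes>\<^bsub>dihedral_group n\<^esub> dih_x n
      = inv\<^bsub>dihedral_group n\<^esub> dih_x n \<otimes>\<^bsub>dihedral_group n\<^esub> dih_a n"
    by (simp add: dihedral_group_mult dih_a_def dih_x_def mod_simps)
qed

lemma generate_dihedral_group: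
  assumes "n > 0"
  shows "generate (dihedral_group n) {dih_x n, dih_a n} = carrier (dihedral_group n)"
proof -
  interpret group "dihedral_group n" by (rule group_dihedral_group[OF assms])
  have sub: "{dih_x n, dih_a n} \<subseteq> carrier (dihedral_group n)"
    using dih_x_closed[OF assms] dih_a_closed[OF assms] by simp
  have sg: "subgroup (generate (dihedral_group n) {dih_x n, dih_a n}) (dihedral_group n)"
    by (rule generate_is_subgroup[OF sub])
  have "u \<in> generate (dihedral_group n) {dih_x n, dih_a n}"
    if u: "u \<in> carrier (dihedral_group n)" for u
  proof -
    obtain i s where us: "u = (i, s)" by (cases u)
    have i: "0 \<le> i" "i < int n"
      using u us by (auto simp: dihedral_group_def residue_ring_def)
    have x: "dih_x n [^]\<^bsub>dihedral_group n\<^esub> i \<in> generate (dihedral_group n) {dih_x n, dih_a n}"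
      by (rule subgroup_int_pow_closed[OF sg]) (auto intro: generate.incl)
    have "u = (if s then dih_x n [^]\<^bsub>dihedral_group n\<^esub> i \<otimes>\<^bsub>dihedral_group n\<^esub> dih_a n
               else dih_x n [^]\<^bsub>dihedral_group n\<^esub> i)"
      using us i by (simp add: dih_x_int_pow[OF assms]) (simp add: dihedral_group_def dih_a_def)
    then show ?thesis
      using x by (auto intro: generate.eng generate.incl)
  qed
  then show ?thesis
    using generate_incl[OF sub] by blast
qed

end

theory Submission
  imports Defs "Jordan_Normal_Form.Char_Poly"
begin

text \<open>
  Write \<open>C\<close> for the group of residues modulo \<open>n = p\<^sup>\<alpha>\<close> and \<open>Y = X + X\<^sup>-\<^sup>1\<close> in its integral group ring.
  The graph is a DSRG iff \<open>t = \<mu>\<close> and \<open>X Y = c X + \<mu> C\<close> with \<open>c = \<lambda> - \<mu>\<close>, which implies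
  \<open>Y\<^sup>2 = c Y + 2\<mu> C\<close>. So \<open>Y\<close> is, up to scaling and a multiple of \<open>C\<close>, a rational idempotent, and
  hence invariant under all units modulo \<open>n\<close>. Comparing \<open>Y\<close> with its translates shows that \<open>Y\<close> is
  constant off a subgroup \<open>p\<^sup>\<gamma>C\<close> and zero on it; the constant is 1 because 2 would give \<open>t = k\<close>.
  Then \<open>X Y = c X + \<mu> C\<close> makes \<open>X\<close> a union of cosets of \<open>p\<^sup>\<gamma>C\<close>. The converse is a computation.
\<close>

subsection \<open>Multipliers of idempotents in the group ring\<close>

lemma prime_dvd_power_add_minus:
  fixes a b :: "'a :: comm_ring_1"
  assumes "prime q"
  shows "of_nat q dvd (a + b) ^ q - a ^ q - b ^ q"
proof -
  define f where "f k = of_nat (q choose k) * a ^ k * b ^ (q - k)" for k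
  have q: "q > 1" using assms prime_gt_1_nat by blast
  have split: "{..q} = insert 0 (insert q {1..<q})" using q by auto
  have "(a + b) ^ q = (\<Sum>k\<le>q. f k)"
    by (simp add: binomial_ring f_def)
  also have "\<dots> = b ^ q + (a ^ q + (\<Sum>k\<in>{1..<q}. f k))"
    unfolding split using q by (simp add: f_def)
  finally have eq: "(a + b) ^ q - a ^ q - b ^ q = (\<Sum>k\<in>{1..<q}. f k)" by simp
  have "of_nat q dvd f k" if "k \<in> {1..<q}" for k
  proof -
    have "q dvd (q choose k)" using that assms by (intro dvd_choose_prime) auto
    then have "(of_nat q :: 'a) dvd of_nat (q choose k)" by (auto elim: dvdE)
    then show ?thesis unfolding f_def by simp
  qed
  then show ?thesis unfolding eq by (rule dvd_sum)
qed

lemma prime_dvd_int_power_minus: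
  fixes a :: int
  assumes "prime q"
  shows "int q dvd a ^ q - a"
proof -
  have q: "q > 0" using assms prime_gt_0_nat by blast
  define b where "b = nat (a mod int q)"
  have b: "int b = a mod int q" using q by (simp add: b_def)
  have "[b ^ q = b] (mod q)"
  proof (cases "q dvd b")
    case True
    then have "q dvd b ^ q" using q by (meson dvd_power dvd_trans)
    then show ?thesis using True by (simp add: cong_def mod_eq_0_iff_dvd)
  next
    case False
    have "[b ^ (q - 1) * b = 1 * b] (mod q)"
      by (intro cong_mult fermat_theorem cong_refl assms False)
    then show ?thesis using q by (simp flip: power_Suc2)
  qed
  then have "[int b ^ q = int b] (mod int q)" by (simp flip: cong_int_iff)
  then have "[a ^ q = a] (mod int q)" by (simp add: b cong_def power_mod)
  then show ?thesis by (simp add: cong_iff_dvd_diff)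
qed

text \<open>Modulo q the q-th power is additive, so induction on the coefficients works: Fermat
  treats the constant term, the induction hypothesis the rest, and the three differences divisible
  by q telescope.\<close>

lemma int_poly_power_prime:
  fixes P :: "int poly"
  assumes "prime q"
  shows "\<exists>A. P ^ q = P \<circ>\<^sub>p monom 1 q + smult (int q) A"
proof -
  have "of_nat q dvd P ^ q - P \<circ>\<^sub>p monom 1 q"
  proof (induction P)
    case 0
    then show ?case using assms by (simp add: prime_gt_0_nat zero_power)
  next
    case (pCons a P)
    have split: "pCons a P = [:a:] + monom 1 1 * P"
      by (simp add: monom_Suc)
    have "of_nat q dvd (pCons a P) ^ q - [:a:] ^ q - (monom 1 1 * P) ^ q"
      unfolding split by (rule prime_dvd_power_add_minus[OF assms])
    moreover have "(monom 1 1 * P) ^ q = monom 1 q * P ^ q"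
      by (simp add: power_mult_distrib monom_power)
    moreover have "(of_nat q :: int poly) dvd [:a:] ^ q - [:a:]"
    proof -
      have "int q dvd a ^ q - a" by (rule prime_dvd_int_power_minus[OF assms])
      then have "[:int q:] dvd [:a ^ q - a:]" by (simp add: const_poly_dvd_const_poly_iff)
      then show ?thesis by (simp add: poly_const_pow of_nat_poly)
    qed
    moreover have "of_nat q dvd monom 1 q * P ^ q - monom 1 q * (P \<circ>\<^sub>p monom 1 q)"
      using pCons.IH by (simp flip: right_diff_distrib)
    ultimately have *: "of_nat q dvd ((pCons a P) ^ q - [:a:] ^ q - monom 1 q * P ^ q)
       + ([:a:] ^ q - [:a:]) + (monom 1 q * P ^ q - monom 1 q * (P \<circ>\<^sub>p monom 1 q))"
      by (metis dvd_add)
    have "((pCons a P) ^ q - [:a:] ^ q - monom 1 q * P ^ q) + ([:a:] ^ q - [:a:])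
        + (monom 1 q * P ^ q - monom 1 q * (P \<circ>\<^sub>p monom 1 q))
        = pCons a P ^ q - pCons a P \<circ>\<^sub>p monom 1 q"
      unfolding pcompose_pCons by (simp only: algebra_simps)
    with * show ?case by (simp only:)
  qed
  then obtain A where "P ^ q - P \<circ>\<^sub>p monom 1 q = of_nat q * A" by (elim dvdE)
  then have "P ^ q = P \<circ>\<^sub>p monom 1 q + smult (int q) A"
    by (simp add: of_nat_poly algebra_simps)
  then show ?thesis by blast
qed

section \<open>Fourier sums over roots of unity and cyclic convolution\<close>

lemma sum_root_of_unity_powers:
  fixes n j :: nat
  assumes "n > 0"
  defines "w \<equiv> cis (2 * pi / n)"
  shows "(\<Sum>l<n. (w ^ l) ^ j) = (if n dvd j then of_nat n else 0)"
proof -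
  have 1: "w ^ j = 1 \<longleftrightarrow> n dvd j"
  proof
    assume "w ^ j = 1"
    then have "cos (j * (2 * pi / n)) = 1"
      by (simp add: w_def Complex.DeMoivre complex_eq_iff)
    then obtain m :: int where "real j * (2 * pi / n) = real_of_int m * 2 * pi"
      using cos_one_2pi_int by blast
    then have "real j = m * n" using assms by (simp add: field_simps)
    then have "int j = m * int n" by (metis of_int_eq_iff of_int_mult of_int_of_nat_eq)
    then show "n dvd j" by (metis dvd_triv_right int_dvd_int_iff)
  next
    assume "n dvd j"
    then obtain m where "j = n * m" by blast
    then have "w ^ j = cis (2 * pi * m)"
      using assms by (simp add: w_def Complex.DeMoivre field_simps)
    then show "w ^ j = 1" by simp
  qed
  have wn: "w ^ n = 1"
    using assms by (simp add: w_def Complex.DeMoivre)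
  \<comment> \<open>Exchanging the two exponents turns the sum into a geometric one with ratio
    \<open>w ^ j\<close>.\<close>
  have eq: "(\<Sum>l<n. (w ^ l) ^ j) = (\<Sum>l<n. (w ^ j) ^ l)"
    by (simp add: mult.commute flip: power_mult)
  show ?thesis
  proof (cases "n dvd j")
    case True
    then show ?thesis using 1 unfolding eq by simp
  next
    case False
    have "(w ^ j) ^ n = 1" by (metis mult.commute power_mult power_one wn)
    then show ?thesis using False 1 unfolding eq by (simp add: geometric_sum)
  qed
qed

text \<open>The right-hand side is n times an integer. Identities between polynomial values at roots
  of unity thus become identities between integers, where divisibility can be used without algebraic
  integers.\<close>

lemma sum_int_poly_roots_of_unity:
  fixes B :: "int poly" and n k :: nat
  assumes "n > 0"
  defines "w \<equiv> cis (2 * pi / n)"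
  shows "(\<Sum>l<n. poly (of_int_poly B) (w ^ l) * (w ^ l) ^ k) =
     of_nat n * of_int (\<Sum>i\<le>degree B. if n dvd i + k then coeff B i else 0)"
proof -
  have "(\<Sum>l<n. poly (of_int_poly B) (w ^ l) * (w ^ l) ^ k)
     = (\<Sum>l<n. \<Sum>i\<le>degree B. of_int (coeff B i) * (w ^ l) ^ (i + k))"
    by (simp add: poly_altdef sum_distrib_right power_add mult.assoc)
  also have "\<dots> = (\<Sum>i\<le>degree B. of_int (coeff B i) * (\<Sum>l<n. (w ^ l) ^ (i + k)))"
    by (subst sum.swap) (simp add: sum_distrib_left)
  also have "\<dots> = of_nat n * of_int (\<Sum>i\<le>degree B. if n dvd i + k then coeff B i else 0)"
    unfolding w_def sum_root_of_unity_powers[OF assms(1)]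
    by (auto simp: sum_distrib_left of_int_sum intro!: sum.cong)
  finally show ?thesis .
qed

lemma sum_periodic_shift:
  fixes f :: "int \<Rightarrow> 'a :: comm_monoid_add"
  assumes "n > 0" and per: "\<And>i. f (i mod n) = f i"
  shows "(\<Sum>i\<in>{0..<n}. f (i + a)) = (\<Sum>i\<in>{0..<n}. f i)"
  by (rule sum.reindex_bij_witness[where i = "\<lambda>i. (i - a) mod n" and j = "\<lambda>i. (i + a) mod n"])
     (use assms in \<open>auto simp: mod_simps\<close>)

lemma sum_periodic_reflect:
  fixes f :: "int \<Rightarrow> 'a :: comm_monoid_add"
  assumes "n > 0" and per: "\<And>i. f (i mod n) = f i"
  shows "(\<Sum>i\<in>{0..<n}. f (a - i)) = (\<Sum>i\<in>{0..<n}. f i)"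
  by (rule sum.reindex_bij_witness[where i = "\<lambda>i. (a - i) mod n" and j = "\<lambda>i. (a - i) mod n"])
     (use assms in \<open>auto simp: mod_simps\<close>)

lemma sum_residue_indicator:
  assumes "X \<subseteq> {0..<int n}"
  shows "(\<Sum>h\<in>{0..<int n}. if h mod int n \<in> X then 1 else 0 :: int) = int (card X)"
proof -
  have "(\<Sum>h\<in>{0..<int n}. if h mod int n \<in> X then 1 else 0 :: int)
      = (\<Sum>h\<in>{0..<int n}. if h \<in> X then 1 else 0)"
    by (intro sum.cong) auto
  also have "\<dots> = int (card ({0..<int n} \<inter> X))" by (simp flip: sum.inter_restrict)
  finally show ?thesis using assms by (simp add: Int_absorb1)
qed

text \<open>For z with z^n = 1 the map i -> z^i is a character of the residues modulo n, and the
  corresponding evaluation turns cyclic convolution into multiplication. A convolution square c F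
  therefore has transform V with V^2 = c V.\<close>

lemma poly_periodic_square:
  fixes F :: "int \<Rightarrow> int" and n :: nat and z :: complex
  assumes n: "n > 0" and per: "\<And>i. F (i mod int n) = F i"
    and conv: "\<And>g. (\<Sum>h\<in>{0..<int n}. F h * F (g - h)) = c * F g"
    and z: "z ^ n = 1"
  shows "(\<Sum>i<n. of_int (F (int i)) * z ^ i)\<^sup>2 = of_int c * (\<Sum>i<n. of_int (F (int i)) * z ^ i)"
proof -
  \<comment> \<open>\<open>e\<close> is the character extended periodically to all integers, which
    avoids negative exponents in the shifts below.\<close>
  define e where "e h = z ^ nat (h mod int n)" for h :: int
  have zmod: "z ^ (m mod n) = z ^ m" for m
  proof -
    have "z ^ m = z ^ (n * (m div n) + m mod n)" by simp
    also have "\<dots> = z ^ (m mod n)" by (simp only: power_add power_mult z) simp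
    finally show ?thesis by simp
  qed
  have e_per: "e (h mod int n) = e h" for h by (simp add: e_def)
  have e_add: "e (a + b) = e a * e b" for a b
  proof -
    have "nat ((a + b) mod int n) = (nat (a mod int n) + nat (b mod int n)) mod n"
      using n by (simp add: nat_mod_distrib nat_add_distrib flip: mod_add_eq[of a "int n" b])
    then show ?thesis by (simp add: e_def zmod power_add)
  qed
  define V where "V = (\<Sum>h\<in>{0..<int n}. of_int (F h) * e h)"
  have V: "(\<Sum>i<n. of_int (F (int i)) * z ^ i) = V"
    unfolding V_def
    by (rule sum.reindex_bij_witness[where i = nat and j = int]) (auto simp: e_def)
  have "V\<^sup>2 = (\<Sum>h\<in>{0..<int n}. of_int (F h) * e h * V)"
    by (simp add: power2_eq_square V_def sum_distrib_right)
  also have "\<dots> = (\<Sum>h\<in>{0..<int n}. \<Sum>g\<in>{0..<int n}. of_int (F h * F (g - h)) * e g)"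
  proof (rule sum.cong[OF refl])
    fix h
    have "V = (\<Sum>g\<in>{0..<int n}. of_int (F (g + - h)) * e (g + - h))"
      unfolding V_def using n
      by (subst sum_periodic_shift[where f = "\<lambda>h. of_int (F h) * e h"]) (simp_all add: per e_per)
    moreover have "e h * e (g - h) = e g" for g by (simp flip: e_add)
    ultimately show "of_int (F h) * e h * V = (\<Sum>g\<in>{0..<int n}. of_int (F h * F (g - h)) * e g)"
      by (auto simp: sum_distrib_left mult_ac intro!: sum.cong)
  qed
  also have "\<dots> = (\<Sum>g\<in>{0..<int n}. of_int (\<Sum>h\<in>{0..<int n}. F h * F (g - h)) * e g)"
    by (subst sum.swap) (simp add: sum_distrib_right)
  also have "\<dots> = of_int c * V"
    by (simp add: conv V_def sum_distrib_left mult_ac)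
  finally show ?thesis unfolding V .
qed

text \<open>
  The discrete Fourier transform of \<open>F\<close> takes values in \<open>{0, c}\<close>, so its difference \<open>D\<close> to the
  transform twisted by \<open>z \<mapsto> z\<^sup>q\<close> satisfies \<open>D\<^sup>3 = c\<^sup>2 D\<close>, while \<open>D\<close> is divisible by \<open>q\<close> by
  the Frobenius congruence. Hence every coefficient of \<open>D\<close> is divisible by every power of \<open>q\<close>.
\<close>

lemma prime_multiplier:
  fixes F :: "int \<Rightarrow> int" and n q :: nat and c :: int
  assumes n: "n > 0" and per: "\<And>i. F (i mod int n) = F i"
    and conv: "\<And>g. (\<Sum>h\<in>{0..<int n}. F h * F (g - h)) = c * F g"
    and q: "prime q" and qc: "\<not> int q dvd c" and qn: "coprime q n"
  shows "F (int q * g) = F g"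
proof -
  define P :: "int poly" where "P = (\<Sum>i<n. monom (F (int i)) i)"
  define ev :: "int poly \<Rightarrow> complex \<Rightarrow> complex" where "ev B = poly (of_int_poly B)" for B
  have ev_simps: "ev (B + C) z = ev B z + ev C z" "ev (B - C) z = ev B z - ev C z"
      "ev (smult a B) z = of_int a * ev B z" "ev (B ^ m) z = ev B z ^ m"
      "ev (B \<circ>\<^sub>p monom 1 m) z = ev B (z ^ m)" for B C z a m
    by (simp_all add: ev_def hom_distribs poly_pcompose poly_monom)
  have evP: "ev P z = (\<Sum>i<n. of_int (F (int i)) * z ^ i)" for z
    by (simp add: ev_def P_def hom_distribs poly_sum poly_monom)
  have P2: "(ev P z)\<^sup>2 = of_int c * ev P z" if "z ^ n = 1" for z
    unfolding evP by (rule poly_periodic_square[OF n per conv that])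
  obtain A where A: "P ^ q = P \<circ>\<^sub>p monom 1 q + smult (int q) A"
    using int_poly_power_prime[OF q] by blast
  have q0: "q > 0" using q prime_gt_0_nat by blast
  have "int q dvd c * (c ^ (q - 1) - 1)"
    using prime_dvd_int_power_minus[OF q, of c] q0
    by (simp add: right_diff_distrib flip: power_Suc)
  then have "int q dvd c ^ (q - 1) - 1"
    using qc q by (simp add: prime_dvd_mult_iff)
  then obtain b where b: "c ^ (q - 1) - 1 = int q * b" by (elim dvdE)
  define D where "D = P - P \<circ>\<^sub>p monom 1 q"
  \<comment> \<open>At n-th roots of unity, P^2 = c P gives P^q = c^(q-1) P = (1 + q b) P, while the
    Frobenius congruence gives P(z)^q = P(z^q) + q A(z). Subtracting shows D = q B there.\<close>
  define B where "B = A - smult b P"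
  have Pq: "ev P z ^ Suc m = of_int c ^ m * ev P z" if "z ^ n = 1" for z m
  proof (induction m)
    case (Suc m)
    have "ev P z ^ Suc (Suc m) = of_int c ^ m * (ev P z)\<^sup>2"
      using Suc by (simp add: power2_eq_square)
    then show ?case by (simp only: P2[OF that] power_Suc2 mult_ac)
  qed simp
  have DB: "ev D z = of_int (int q) * ev B z" if z: "z ^ n = 1" for z
  proof -
    have "ev P z ^ q = of_int (1 + int q * b) * ev P z"
      using Pq[OF z, of "q - 1"] q0 b
      by (simp flip: of_int_power) (simp add: algebra_simps flip: of_int_power)
    moreover have "ev P z ^ q = ev P (z ^ q) + of_int (int q) * ev A z"
      using arg_cong[OF A, of "\<lambda>P. ev P z"] by (simp add: ev_simps)
    ultimately show ?thesis by (simp add: D_def B_def ev_simps algebra_simps)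
  qed
  \<comment> \<open>Both P(z) and P(z^q) lie in {0, c}, so D(z) lies in {0, c, -c}.\<close>
  have D3: "ev D z ^ 3 = of_int c ^ 2 * ev D z" if z: "z ^ n = 1" for z
  proof -
    have zq: "(z ^ q) ^ n = 1" by (metis z mult.commute power_mult power_one)
    have "ev P z = 0 \<or> ev P z = of_int c" "ev P (z ^ q) = 0 \<or> ev P (z ^ q) = of_int c"
      using P2[OF z] P2[OF zq] by (auto simp: power2_eq_square)
    then show ?thesis by (auto simp: D_def ev_simps power2_eq_square power3_eq_cube)
  qed
  have Dpow: "of_int c ^ (2 * m) * ev D z = of_int (int q) ^ (2 * m + 1) * ev (B ^ (2 * m + 1)) z"
    if z: "z ^ n = 1" for z m
  proof -
    have "ev D z ^ (2 * m + 1) = of_int c ^ (2 * m) * ev D z"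
    proof (induction m)
      case (Suc m)
      have "ev D z ^ (2 * Suc m + 1) = ev D z ^ 2 * ev D z ^ (2 * m + 1)"
        by (simp add: power_add power2_eq_square)
      also have "\<dots> = of_int c ^ (2 * m) * ev D z ^ 3"
        unfolding Suc by (simp add: power2_eq_square power3_eq_cube)
      also have "\<dots> = of_int c ^ (2 * Suc m) * ev D z"
        by (simp add: D3[OF z] power_add power2_eq_square)
      finally show ?case .
    qed simp
    moreover have "of_int (int q) ^ (2 * m + 1) * ev (B ^ (2 * m + 1)) z = ev D z ^ (2 * m + 1)"
      by (simp only: DB[OF z] ev_simps power_mult_distrib)
    ultimately show ?thesis by (simp only:)
  qed
  define w where "w = cis (2 * pi / n)"
  have wl: "(w ^ l) ^ n = 1" for l
  proof -
    have "w ^ n = 1" using n by (simp add: w_def Complex.DeMoivre)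
    then show ?thesis by (metis mult.commute power_mult power_one)
  qed
  \<comment> \<open>\<open>R B k\<close> collects the coefficients of \<open>B\<close> at exponents
    congruent to -k modulo n. It is 1/n times the Fourier sum, hence depends only on the values of
    \<open>B\<close> at n-th roots of unity.\<close>
  define R where "R B k = (\<Sum>i\<le>degree B. if n dvd i + k then coeff B i else 0)" for B :: "int poly" and k
  have R: "(\<Sum>l<n. ev B (w ^ l) * (w ^ l) ^ k) = of_nat n * of_int (R B k)" for B k
    unfolding ev_def w_def R_def by (rule sum_int_poly_roots_of_unity[OF n])
  have R0: "R D k = 0" for k
  proof (rule ccontr)
    assume nz: "R D k \<noteq> 0"
    \<comment> \<open>With this \<open>m\<close> the power q^(2m+1) exceeds |R D k|. It divides
      c^(2m) R D k, and c is prime to q, so it would divide the nonzero integer R D k.\<close>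
    define m where "m = nat \<bar>R D k\<bar>"
    have "of_int (c ^ (2 * m)) * (of_nat n * of_int (R D k))
        = (\<Sum>l<n. of_int c ^ (2 * m) * ev D (w ^ l) * (w ^ l) ^ k)"
      by (simp add: sum_distrib_left mult.assoc flip: R)
    also have "\<dots> = of_int (int q ^ (2 * m + 1)) * (of_nat n * of_int (R (B ^ (2 * m + 1)) k))"
      by (subst Dpow[OF wl]) (simp add: sum_distrib_left mult.assoc flip: R)
    finally have "of_nat n * of_int (c ^ (2 * m) * R D k)
        = (of_nat n * of_int (int q ^ (2 * m + 1) * R (B ^ (2 * m + 1)) k) :: complex)"
      by (simp add: mult_ac)
    then have "c ^ (2 * m) * R D k = int q ^ (2 * m + 1) * R (B ^ (2 * m + 1)) k"
      using n by (simp only: mult_cancel_left of_int_eq_iff of_nat_eq_0_iff) simp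
    then have "int q ^ (2 * m + 1) dvd c ^ (2 * m) * R D k" by simp
    moreover have "coprime (int q ^ (2 * m + 1)) (c ^ (2 * m))"
      using prime_imp_coprime[of "int q" c] q qc by simp
    ultimately have "int q ^ (2 * m + 1) dvd R D k" by (simp add: coprime_dvd_mult_right_iff)
    then have "int q ^ (2 * m + 1) \<le> \<bar>R D k\<bar>"
      using dvd_imp_le_int[OF nz, of "int q ^ (2 * m + 1)"] by (simp add: abs_mult power_abs)
    moreover have "m < q ^ m"
    proof (rule less_le_trans)
      show "m < 2 ^ m" by (rule less_exp)
      show "2 ^ m \<le> q ^ m" using prime_ge_2_nat[OF q] by (intro power_mono) auto
    qed
    then have "int m < int q ^ m" by (simp flip: of_nat_power)
    moreover have "int q ^ m \<le> int q ^ (2 * m + 1)"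
      using q0 by (intro power_increasing) auto
    ultimately show False by (simp add: m_def)
  qed
  define g0 where "g0 = nat (g mod int n)"
  have g0: "g0 < n" "int g0 = g mod int n" using n by (simp_all add: g0_def nat_less_iff)
  \<comment> \<open>A natural number congruent to -q g0 modulo n; it makes the Fourier sums select
    the exponents congruent to q g0.\<close>
  define k where "k = q * g0 * (n - 1)"
  have k: "n dvd j + k \<longleftrightarrow> [j = q * g0] (mod n)" for j
  proof -
    have "q * g0 + k = q * g0 * n" using n by (cases n) (simp_all add: k_def)
    then have "[q * g0 + k = 0] (mod n)" by (simp add: cong_def)
    then show ?thesis
      by (metis cong_0_iff cong_add_rcancel_nat cong_sym cong_trans)
  qed
  \<comment> \<open>Used twice: r = 1 selects i = q g0 mod n, giving F(q g), and r = q selects i =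
    g0 because q is invertible modulo n, giving F(g). The two agree since R D vanishes.\<close>
  have sumk: "(\<Sum>l<n. ev P ((w ^ l) ^ r) * (w ^ l) ^ k)
      = of_nat n * of_int (\<Sum>i<n. if [r * i = q * g0] (mod n) then F (int i) else 0)" for r
  proof -
    have "(\<Sum>l<n. ev P ((w ^ l) ^ r) * (w ^ l) ^ k)
        = (\<Sum>l<n. \<Sum>i<n. of_int (F (int i)) * (w ^ l) ^ (r * i + k))"
      by (simp add: evP sum_distrib_right power_add mult.assoc flip: power_mult)
    also have "\<dots> = (\<Sum>i<n. of_int (F (int i)) * (\<Sum>l<n. (w ^ l) ^ (r * i + k)))"
      by (subst sum.swap) (simp add: sum_distrib_left)
    also have "\<dots> = (\<Sum>i<n. of_nat n * of_int (if [r * i = q * g0] (mod n) then F (int i) else 0))"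
      unfolding w_def sum_root_of_unity_powers[OF n] k by (intro sum.cong) auto
    finally show ?thesis by (simp add: sum_distrib_left)
  qed
  have "(\<Sum>l<n. ev P ((w ^ l) ^ 1) * (w ^ l) ^ k) - (\<Sum>l<n. ev P ((w ^ l) ^ q) * (w ^ l) ^ k)
      = (\<Sum>l<n. ev D (w ^ l) * (w ^ l) ^ k)"
    by (simp add: D_def ev_simps left_diff_distrib sum_subtractf)
  also have "\<dots> = 0" by (simp add: R R0)
  finally have "(of_nat n * of_int (\<Sum>i<n. if [1 * i = q * g0] (mod n) then F (int i) else 0) :: complex)
      = of_nat n * of_int (\<Sum>i<n. if [q * i = q * g0] (mod n) then F (int i) else 0)"
    unfolding sumk by simp
  then have eq: "(\<Sum>i<n. if [1 * i = q * g0] (mod n) then F (int i) else 0)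
      = (\<Sum>i<n. if [q * i = q * g0] (mod n) then F (int i) else 0)"
    using n by (simp only: mult_cancel_left of_int_eq_iff of_nat_eq_0_iff) simp
  have "(\<Sum>i<n. if [1 * i = q * g0] (mod n) then F (int i) else 0)
      = (\<Sum>i<n. if i = q * g0 mod n then F (int i) else 0)"
    by (intro sum.cong) (auto simp: cong_def)
  also have "\<dots> = F (int (q * g0 mod n))" using n by simp
  also have "\<dots> = F (int q * g)"
    by (metis g0(2) mod_mult_right_eq of_nat_mult per zmod_int)
  finally have 1: "(\<Sum>i<n. if [1 * i = q * g0] (mod n) then F (int i) else 0) = F (int q * g)" .
  have "(\<Sum>i<n. if [q * i = q * g0] (mod n) then F (int i) else 0)
      = (\<Sum>i<n. if i = g0 then F (int i) else 0)"
    using qn g0(1) by (intro sum.cong) (auto simp: cong_mult_lcancel_nat cong_less_modulus_unique_nat)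
  also have "\<dots> = F g" using g0 per by simp
  finally show ?thesis using eq 1 by simp
qed

text \<open>Let k be the product of the primes dividing c but not u. Each prime divisor of c divides
  exactly one of u and k, and one dividing u does not divide n, so it never divides u + n k. This
  moves a unit modulo n to a representative prime to c as well.\<close>

lemma coprime_shift_exists:
  fixes u n c :: nat
  assumes "coprime u n" and "c > 0"
  shows "\<exists>k. coprime (u + n * k) c"
proof -
  define k where "k = \<Prod>{r. prime r \<and> r dvd c \<and> \<not> r dvd u}"
  have fin: "finite {r. prime r \<and> r dvd c \<and> \<not> r dvd u}"
    by (rule finite_subset[OF _ finite_divisors_nat[OF assms(2)]]) auto
  have k: "r dvd k \<longleftrightarrow> \<not> r dvd u" if "prime r" "r dvd c" for r
  proof
    assume "r dvd k"
    then obtain s where "prime s" "\<not> s dvd u" "r dvd s"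
      using \<open>prime r\<close> prime_dvd_prod_iff[OF fin, of r "\<lambda>s. s"] by (auto simp: k_def)
    then show "\<not> r dvd u" using that primes_dvd_imp_eq by blast
  next
    assume "\<not> r dvd u"
    then show "r dvd k" using that fin unfolding k_def by (intro dvd_prodI) auto
  qed
  have "coprime (u + n * k) c"
  proof (rule ccontr)
    assume "\<not> coprime (u + n * k) c"
    then obtain r where r: "prime r" "r dvd u + n * k" "r dvd c"
      using prime_factor_nat[of "gcd (u + n * k) c"] by (auto simp: coprime_iff_gcd_eq_1)
    show False
    proof (cases "r dvd u")
      case True
      then have "r dvd n * k" using r(2) dvd_add_right_iff by blast
      moreover have "\<not> r dvd n" using assms(1) True r(1)
        by (metis coprime_common_divisor not_prime_unit)
      ultimately show False using k[OF r(1,3)] True r(1) by (simp add: prime_dvd_mult_iff)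
    next
      case False
      then show False using k[OF r(1,3)] r(2)
        by (metis dvd_add_left_iff dvd_mult)
    qed
  qed
  then show ?thesis ..
qed

text \<open>\<open>prime_multiplier\<close> excludes primes dividing c. Hence u is first replaced by
  a representative of its class prime to n c, which is then built up one prime factor at a
  time.\<close>

lemma unit_multiplier:
  fixes F :: "int \<Rightarrow> int" and n u :: nat and c :: int
  assumes n: "n > 0" and per: "\<And>i. F (i mod int n) = F i"
    and conv: "\<And>g. (\<Sum>h\<in>{0..<int n}. F h * F (g - h)) = c * F g"
    and c: "c \<noteq> 0" and u: "coprime u n"
  shows "F (int u * g) = F g"
proof -
  obtain k where k: "coprime (u + n * k) (n * nat \<bar>c\<bar>)"
    using coprime_shift_exists[OF u, of "n * nat \<bar>c\<bar>"] n c by auto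
  have "\<forall>g. F (int v * g) = F g" if "coprime v (n * nat \<bar>c\<bar>)" for v
    using that
  proof (induction v rule: prime_divisors_induct)
    \<comment> \<open>Zero is coprime to n |c| only if that product is 1, and then \<open>F\<close>
      is constant.\<close>
    case zero
    then have "n = 1" by simp
    then have "F g = F 0" for g using per[of g] by simp
    then show ?case by metis
  next
    case (unit v)
    then show ?case by simp
  next
    case (factor q v)
    have "\<not> q dvd nat \<bar>c\<bar>"
      using factor(1,3) by (metis coprime_common_divisor coprime_mult_left_iff coprime_mult_right_iff
          dvd_refl not_prime_unit)
    then have "\<not> int q dvd c" by (metis dvd_abs_iff int_dvd_int_iff nat_0_le abs_ge_zero)
    moreover have "coprime q n" using factor(3) by simp
    ultimately have "F (int q * h) = F h" for h
      using prime_multiplier[OF n per conv factor(1)] by blast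
    moreover have "F (int v * h) = F h" for h using factor by simp
    ultimately show ?case by (simp add: mult.assoc)
  qed
  from this[OF k] have "F (int (u + n * k) * g) = F g" by blast
  moreover have "int (u + n * k) * g = int u * g + int k * g * int n"
    by (simp add: algebra_simps)
  then have "int (u + n * k) * g mod int n = int u * g mod int n"
    by simp
  ultimately show ?thesis using per by metis
qed

subsection \<open>Symmetric functions with quadratic convolution square\<close>

text \<open>Expand the square. As Y is even, correlation and convolution coincide, so the squares
  contribute the convolution at 0 and the cross terms the convolution at -g; the constant m
  cancels.\<close>

lemma sum_translate_diff_square:
  fixes Y :: "int \<Rightarrow> int"
  assumes n: "n > 0" and per: "\<And>i. Y (i mod n) = Y i" and even: "\<And>i. Y (- i) = Y i"
    and conv: "\<And>g. (\<Sum>h\<in>{0..<n}. Y h * Y (g - h)) = c * Y g + m"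
  shows "(\<Sum>h\<in>{0..<n}. (Y (h + g) - Y h)\<^sup>2) = 2 * c * (Y 0 - Y g)"
proof -
  have 0: "(\<Sum>h\<in>{0..<n}. (Y h)\<^sup>2) = c * Y 0 + m"
    using conv[of 0] by (simp add: even power2_eq_square)
  have 1: "(\<Sum>h\<in>{0..<n}. (Y (h + g))\<^sup>2) = c * Y 0 + m"
    using sum_periodic_shift[OF n, of "\<lambda>h. (Y h)\<^sup>2" g] by (simp add: per 0)
  have "Y (- g - h) = Y (h + g)" for h using even[of "h + g"] by (simp add: algebra_simps)
  then have 2: "(\<Sum>h\<in>{0..<n}. Y h * Y (h + g)) = c * Y g + m"
    using conv[of "- g"] by (simp add: even)
  have "(Y (h + g) - Y h)\<^sup>2 = (Y (h + g))\<^sup>2 + (Y h)\<^sup>2 - 2 * (Y h * Y (h + g))" for h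
    by (simp add: power2_diff)
  then have "(\<Sum>h\<in>{0..<n}. (Y (h + g) - Y h)\<^sup>2)
      = (c * Y 0 + m) + (c * Y 0 + m) - 2 * (c * Y g + m)"
    by (simp add: sum.distrib sum_subtractf 0 1 2 flip: sum_distrib_left)
  then show ?thesis by (simp add: algebra_simps)
qed

text \<open>Passing from Y to F = n Y - s, where s is the total sum, removes the constant m. Summing
  the hypothesis over g gives s^2 = c s + n m, exactly what makes the convolution square of F equal
  to n c F.\<close>

lemma unit_multiplier_affine:
  fixes Y :: "int \<Rightarrow> int" and n :: nat and u :: int
  assumes n: "n > 0" and per: "\<And>i. Y (i mod int n) = Y i"
    and conv: "\<And>g. (\<Sum>h\<in>{0..<int n}. Y h * Y (g - h)) = c * Y g + m"
    and c: "c \<noteq> 0" and u: "coprime u (int n)"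
  shows "Y (u * g) = Y g"
proof -
  define s where "s = (\<Sum>h\<in>{0..<int n}. Y h)"
  have refl: "(\<Sum>h\<in>{0..<int n}. Y (g - h)) = s" for g
    unfolding s_def using n by (intro sum_periodic_reflect) (simp_all add: per)
  have "s * s = (\<Sum>h\<in>{0..<int n}. Y h * (\<Sum>g\<in>{0..<int n}. Y (g - h)))"
  proof -
    have "(\<Sum>g\<in>{0..<int n}. Y (g - h)) = s" for h
      unfolding s_def using sum_periodic_shift[of "int n" Y "- h"] n by (simp add: per)
    then show ?thesis by (simp add: s_def sum_distrib_right)
  qed
  also have "\<dots> = (\<Sum>g\<in>{0..<int n}. \<Sum>h\<in>{0..<int n}. Y h * Y (g - h))"
    unfolding sum_distrib_left by (rule sum.swap)
  also have "\<dots> = c * s + int n * m"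
    by (simp add: conv sum.distrib s_def flip: sum_distrib_left)
  finally have s2: "s * s = c * s + int n * m" .
  define F where "F g = int n * Y g - s" for g
  have Fconv: "(\<Sum>h\<in>{0..<int n}. F h * F (g - h)) = (int n * c) * F g" for g
  proof -
    have "F h * F (g - h) = (int n * int n) * (Y h * Y (g - h)) - (int n * s) * Y h
        - (int n * s) * Y (g - h) + s * s" for h
      by (simp add: F_def algebra_simps)
    then have "(\<Sum>h\<in>{0..<int n}. F h * F (g - h))
      = (int n * int n) * (c * Y g + m) - (int n * s) * s - (int n * s) * s + int n * (s * s)"
      by (simp add: sum.distrib sum_subtractf conv refl flip: sum_distrib_left s_def)
    also have "\<dots> = int n * (int n * c * Y g + int n * m - s * s)"
      by (simp add: algebra_simps)
    also have "\<dots> = (int n * c) * F g" unfolding s2 by (simp add: F_def algebra_simps)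
    finally show ?thesis .
  qed
  define v where "v = nat (u mod int n)"
  have v: "int v = u mod int n" using n by (simp add: v_def)
  then have "coprime (int v) (int n)" using u n by simp
  then have "coprime v n" by simp
  then have "F (int v * g) = F g"
    using n c by (intro unit_multiplier[OF n _ Fconv]) (simp_all add: F_def per)
  then have "Y (int v * g) = Y g" using n by (simp add: F_def)
  moreover have "(int v * g) mod int n = (u * g) mod int n" by (simp add: v mod_simps)
  ultimately show ?thesis by (metis per)
qed

lemma sum_multiples_indicator:
  fixes N r :: int
  assumes "N > 0" "r \<ge> 0"
  shows "(\<Sum>h\<in>{0..<N * r}. if N dvd h then k else 0) = r * (k :: int)"
proof -
  have "(\<Sum>h\<in>{0..<N * r}. if N dvd h then k else 0) = (\<Sum>h\<in>{h\<in>{0..<N * r}. N dvd h}. k)"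
    by (rule sum.inter_filter[symmetric]) simp
  also have "{h\<in>{0..<N * r}. N dvd h} = (*) N ` {0..<r}"
    using assms by (auto simp: zero_le_mult_iff elim!: dvdE)
  also have "(\<Sum>h\<in>(*) N ` {0..<r}. k) = r * k"
    using assms by (simp add: card_image inj_on_def)
  finally show ?thesis .
qed

text \<open>
  By unit invariance \<open>Y g\<close> only depends on the power of \<open>p\<close> dividing \<open>g\<close>. The subgroup generated
  by \<open>p\<^sup>\<gamma>\<close> is the largest one on which \<open>Y\<close> vanishes; comparing the distances between \<open>Y\<close> and
  its translates then forces \<open>Y\<close> to be constant off that subgroup.
\<close>

lemma prime_power_convolution_two_valued:
  fixes Y :: "int \<Rightarrow> int" and p \<alpha> :: nat
  assumes p: "prime p" "odd p" and per: "\<And>i. Y (i mod int (p ^ \<alpha>)) = Y i"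
    and even: "\<And>i. Y (- i) = Y i" and Y0: "Y 0 = 0" and val: "\<And>i. Y i \<in> {0, 1, 2}"
    and nz: "Y g0 \<noteq> 0"
    and conv: "\<And>g. (\<Sum>h\<in>{0..<int (p ^ \<alpha>)}. Y h * Y (g - h)) = c * Y g + m"
  obtains \<gamma> y where "1 \<le> \<gamma>" "\<gamma> \<le> \<alpha>" "y \<in> {1, 2}" "c = - y * int (p ^ (\<alpha> - \<gamma>))"
    "\<And>g. Y g = (if int (p ^ \<gamma>) dvd g then 0 else y)"
proof -
  define n where "n = p ^ \<alpha>"
  have p3: "p \<ge> 3" using p prime_ge_2_nat[OF p(1)] by (cases "p = 2") auto
  have n: "n > 0" using p3 by (simp add: n_def)
  have intp: "prime (int p)" using p by simp
  note per' = per[folded n_def] and conv' = conv[folded n_def]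
  have E: "(\<Sum>h\<in>{0..<int n}. (Y (h + g) - Y h)\<^sup>2) = - 2 * c * Y g" for g
    using sum_translate_diff_square[OF _ per' even conv', of g] n by (simp add: Y0)
  have c: "c \<noteq> 0"
  proof
    assume "c = 0"
    then have "(\<Sum>h\<in>{0..<int n}. (Y (h + g0) - Y h)\<^sup>2) = 0" using E by simp
    then have "\<forall>h\<in>{0..<int n}. (Y (h + g0) - Y h)\<^sup>2 = 0" by (subst (asm) sum_nonneg_eq_0_iff) auto
    from bspec[OF this, of 0] have "Y (0 + g0) - Y 0 = 0" using n by simp
    then show False using nz Y0 by simp
  qed
  have inv: "Y (u * g) = Y g" if "\<not> int p dvd u" for u g
  proof -
    have "coprime u (int n)"
      using that prime_imp_coprime[OF intp that] by (simp add: n_def coprime_commute)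
    then show ?thesis by (rule unit_multiplier_affine[OF n per' conv' c])
  qed
  \<comment> \<open>Write g = p^j g' with j < v and let i invert g' modulo n. Then u = 1 + p^(v-j)
    h' i is prime to p and u g is congruent to g + h, so the shift by h is multiplication by a
    unit.\<close>
  have K: "Y (g + h) = Y g" if g: "\<not> int p ^ v dvd g" and h: "int p ^ v dvd h" for g h v
  proof -
    have "g \<noteq> 0" using g by auto
    then obtain g' where g': "g = int p ^ multiplicity (int p) g * g'" "\<not> int p dvd g'"
      using multiplicity_decompose'[of g "int p"] intp by (metis not_prime_unit)
    define j where "j = multiplicity (int p) g"
    have gj: "g = int p ^ j * g'" using g'(1) by (simp add: j_def)
    have j: "j < v" using g gj by (metis dvd_triv_left le_imp_power_dvd dvd_trans not_le)
    obtain h' where h': "h = int p ^ v * h'" using h by (elim dvdE)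
    have "coprime g' (int n)"
      using prime_imp_coprime[OF intp g'(2)] by (simp add: n_def coprime_commute)
    then obtain i where i: "[g' * i = 1] (mod int n)" using cong_solve_coprime_int by blast
    define u where "u = 1 + int p ^ (v - j) * h' * i"
    have "int p dvd int p ^ (v - j) * h' * i" using j by (simp add: dvd_power)
    then have "\<not> int p dvd u"
      using intp unfolding u_def by (metis dvd_add_left_iff not_prime_unit)
    then have "Y (u * g) = Y g" by (rule inv)
    moreover have "u * g = g + int p ^ (v - j) * int p ^ j * h' * (g' * i)"
      by (simp add: u_def gj algebra_simps)
    then have "u * g = g + h * (g' * i)"
      using j by (simp add: h' flip: power_add)
    moreover have "[g + h * (g' * i) = g + h * 1] (mod int n)"
      by (intro cong_add cong_mult cong_refl i)
    ultimately show ?thesis by (metis cong_def mult_1_right per')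
  qed
  have L: "Y g = Y (int p ^ v)" if g: "int p ^ v dvd g" "\<not> int p ^ Suc v dvd g" for g v
  proof -
    obtain g' where g': "g = int p ^ v * g'" using g(1) by (elim dvdE)
    then have "\<not> int p dvd g'" using g(2) by auto
    then show ?thesis using inv[of g' "int p ^ v"] by (simp add: g' mult.commute)
  qed
  define Z where "Z v \<longleftrightarrow> (\<forall>g. int p ^ v dvd g \<longrightarrow> Y g = 0)" for v
  have "Z \<alpha>" unfolding Z_def using per Y0 by (metis dvd_imp_mod_0 of_nat_power)
  define \<gamma> where "\<gamma> = (LEAST v. Z v)"
  have Z: "Z \<gamma>" and \<gamma>\<alpha>: "\<gamma> \<le> \<alpha>"
    using \<open>Z \<alpha>\<close> unfolding \<gamma>_def by (auto intro: LeastI Least_le)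
  have \<gamma>1: "\<gamma> \<ge> 1" using Z nz by (cases \<gamma>) (auto simp: Z_def)
  define M where "M = int p ^ (\<gamma> - 1)"
  \<comment> \<open>Modulo n the multiples of \<open>N\<close> form a subgroup of order
    \<open>r\<close>, and those of \<open>M\<close> a subgroup of order p r. Minimality of \<gamma>
    makes Y nonzero somewhere on the larger one.\<close>
  define N where "N = int p ^ \<gamma>"
  define r where "r = int p ^ (\<alpha> - \<gamma>)"
  have NM: "N = int p * M" unfolding N_def M_def using \<gamma>1 by (simp flip: power_Suc)
  have nN: "int n = N * r" using \<gamma>\<alpha> by (simp add: n_def N_def r_def flip: power_add)
  have nM: "int n = M * (int p * r)" by (simp add: nN NM)
  have pos: "M > 0" "N > 0" "r > 0" using p3 by (simp_all add: M_def N_def r_def)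
  have MN: "M dvd N" by (simp add: NM)
  have YN: "Y g = 0" if "N dvd g" for g using Z that by (simp add: Z_def N_def)
  have "\<gamma> - 1 < \<gamma>" using \<gamma>1 by simp
  then have "\<not> Z (\<gamma> - 1)" unfolding \<gamma>_def by (rule not_less_Least)
  then obtain g1 where g1: "M dvd g1" "Y g1 \<noteq> 0" by (auto simp: Z_def M_def)
  define y where "y = Y M"
  have YM: "Y g = y" if "M dvd g" "\<not> N dvd g" for g
    using L[of "\<gamma> - 1" g] that \<gamma>1 by (simp add: M_def N_def y_def)
  have "y \<noteq> 0" using YM[of g1] YN[of g1] g1 by auto
  then have y: "y \<in> {1, 2}" using val[of M] by (simp add: y_def)
  have NM': "\<not> N dvd M" using YN[of M] \<open>y \<noteq> 0\<close> by (auto simp: y_def)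
  have dvd_per: "N dvd h mod int n \<longleftrightarrow> N dvd h" "M dvd h mod int n \<longleftrightarrow> M dvd h" for h
    using dvd_triv_left[of N r, folded nN] dvd_triv_left[of M "int p * r", folded nM]
    by (simp_all add: dvd_mod_iff)
  \<comment> \<open>Translating by \<open>M\<close> changes Y only where h or h + M is a multiple of
    \<open>N\<close>, each time by y in absolute value. Both classes have r elements, so -2 c y = 2
    r y^2.\<close>
  have cval: "c = - y * r"
  proof -
    have "(Y (h + M) - Y h)\<^sup>2
        = (if N dvd h then y\<^sup>2 else 0) + (if N dvd h + M then y\<^sup>2 else 0)" for h
    proof -
      consider "N dvd h" | "N dvd h + M" "\<not> N dvd h" | "M dvd h" "\<not> N dvd h" "\<not> N dvd h + M"
        | "\<not> M dvd h" "\<not> N dvd h" "\<not> N dvd h + M" by blast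
      then show ?thesis
      proof cases
        case 1
        then have "\<not> N dvd h + M" using NM' by (simp add: dvd_add_right_iff)
        moreover have "M dvd h + M" using 1 MN by (meson dvd_add dvd_refl dvd_trans)
        ultimately show ?thesis using 1 YN YM by simp
      next
        case 2
        then have "M dvd h" using MN by (metis dvd_add_left_iff dvd_refl dvd_trans)
        then show ?thesis using 2 YN YM by simp
      next
        case 3
        then have "M dvd h + M" by simp
        then show ?thesis using 3 YM by simp
      next
        case 4
        then show ?thesis using K[of "\<gamma> - 1" h M] by (simp add: M_def)
      qed
    qed
    then have "- 2 * c * y = (\<Sum>h\<in>{0..<int n}. if N dvd h then y\<^sup>2 else 0)
       + (\<Sum>h\<in>{0..<int n}. if N dvd h + M then y\<^sup>2 else 0)"
      using E[of M] by (simp add: y_def sum.distrib)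
    also have "(\<Sum>h\<in>{0..<int n}. if N dvd h + M then y\<^sup>2 else 0)
        = (\<Sum>h\<in>{0..<int n}. if N dvd h then y\<^sup>2 else 0)"
      using n by (intro sum_periodic_shift[where f = "\<lambda>h. if N dvd h then y\<^sup>2 else 0"])
        (simp_all add: dvd_per)
    also have "(\<Sum>h\<in>{0..<int n}. if N dvd h then y\<^sup>2 else 0) = r * y\<^sup>2"
      unfolding nN using pos by (intro sum_multiples_indicator) auto
    finally have "y * (- c) = y * (y * r)" by (simp add: power2_eq_square algebra_simps)
    then have "- c = y * r" using \<open>y \<noteq> 0\<close> by (metis mult_cancel_left)
    then show ?thesis by simp
  qed
  \<comment> \<open>In the distance between Y and its translate by g, keep only the h with h or h +
    g in the subgroup of \<open>M\<close>. These sets are disjoint as g lies outside it, and by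
    \<open>K\<close> the summand there compares Y(g) with a value of Y on the subgroup.\<close>
  have Yg: "Y g = y" if Mg: "\<not> M dvd g" for g
  proof -
    define f where "f h = (if M dvd h then (Y g - Y h)\<^sup>2 else 0)" for h
    have "f h + f (h + g) \<le> (Y (h + g) - Y h)\<^sup>2" for h
    proof -
      consider "M dvd h" "\<not> M dvd h + g" | "\<not> M dvd h" "M dvd h + g" | "\<not> M dvd h" "\<not> M dvd h + g"
        using Mg by (metis dvd_add_right_iff)
      then show ?thesis
      proof cases
        case 1
        then have "Y (g + h) = Y g" using K[of "\<gamma> - 1" g h] Mg by (simp add: M_def)
        then show ?thesis using 1 by (simp add: f_def add.commute)
      next
        case 2
        have "Y (- g + (h + g)) = Y (- g)" using K[of "\<gamma> - 1" "- g" "h + g"] Mg 2 by (simp add: M_def)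
        then have "Y h = Y g" by (simp add: even)
        then show ?thesis using 2 by (simp add: f_def power2_commute)
      qed (simp add: f_def)
    qed
    then have "(\<Sum>h\<in>{0..<int n}. f h) + (\<Sum>h\<in>{0..<int n}. f (h + g)) \<le> - 2 * c * Y g"
      unfolding E[symmetric] sum.distrib[symmetric] by (rule sum_mono)
    also have "(\<Sum>h\<in>{0..<int n}. f (h + g)) = (\<Sum>h\<in>{0..<int n}. f h)"
      using n by (intro sum_periodic_shift) (simp_all add: f_def dvd_per per')
    \<comment> \<open>On the multiples of \<open>M\<close> the value is y, except on those of
      \<open>N\<close>, where it is 0; the second sum corrects for the exception.\<close>
    also have "(\<Sum>h\<in>{0..<int n}. f h) = (\<Sum>h\<in>{0..<int n}. if M dvd h then (Y g - y)\<^sup>2 else 0)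
        + (\<Sum>h\<in>{0..<int n}. if N dvd h then (Y g)\<^sup>2 - (Y g - y)\<^sup>2 else 0)"
      unfolding sum.distrib[symmetric] f_def using MN
      by (intro sum.cong) (auto simp: YN YM intro: dvd_trans)
    also have "(\<Sum>h\<in>{0..<int n}. if M dvd h then (Y g - y)\<^sup>2 else 0) = (int p * r) * (Y g - y)\<^sup>2"
      unfolding nM using pos by (intro sum_multiples_indicator) auto
    also have "(\<Sum>h\<in>{0..<int n}. if N dvd h then (Y g)\<^sup>2 - (Y g - y)\<^sup>2 else 0)
        = r * ((Y g)\<^sup>2 - (Y g - y)\<^sup>2)"
      unfolding nN using pos by (intro sum_multiples_indicator) auto
    finally have "r * ((int p - 1) * (Y g - y)\<^sup>2 + (Y g)\<^sup>2) \<le> r * (y * Y g)"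
      by (simp add: cval algebra_simps)
    then have "(int p - 1) * (Y g - y)\<^sup>2 + (Y g)\<^sup>2 \<le> y * Y g" using pos by simp
    moreover have "2 * (Y g - y)\<^sup>2 \<le> (int p - 1) * (Y g - y)\<^sup>2"
      using p3 by (intro mult_right_mono) auto
    \<comment> \<open>The factor 2, available since p >= 3, matters: with factor 1 the case y = 2,
      Y(g) = 1 would survive.\<close>
    ultimately have "2 * (Y g - y)\<^sup>2 + (Y g)\<^sup>2 \<le> y * Y g" by linarith
    then show "Y g = y" using y val[of g] by auto
  qed
  show thesis
  proof (rule that[of \<gamma> y])
    show "Y g = (if int (p ^ \<gamma>) dvd g then 0 else y)" for g
      using YN[of g] YM[of g] Yg[of g] by (auto simp: N_def)
  qed (use \<gamma>1 \<gamma>\<alpha> y cval in \<open>simp_all add: r_def\<close>)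
qed

subsection \<open>Dihedrants as directed strongly regular graphs\<close>

text \<open>Reindexing along the bijection from indices to vertices removes the enumeration: every
  enumeration gives the same condition, and one exists because the vertex set is finite.\<close>

lemma is_dsrg_iff_sums:
  fixes G :: "('a, 'b) pre_digraph"
  defines "a \<equiv> \<lambda>u v. if u \<rightarrow>\<^bsub>G\<^esub> v then 1 else 0 :: int"
  assumes G: "digraph G" and n: "card (verts G) = n"
  shows "is_dsrg G n k \<mu> lam t \<longleftrightarrow>
    (\<forall>u\<in>verts G. (\<Sum>v\<in>verts G. a u v) = int k) \<and>
    (\<forall>v\<in>verts G. (\<Sum>u\<in>verts G. a u v) = int k) \<and>
    (\<forall>u\<in>verts G. \<forall>v\<in>verts G. (\<Sum>w\<in>verts G. a u w * a w v) =
       (if u = v then int t else if u \<rightarrow>\<^bsub>G\<^esub> v then int lam else int \<mu>))"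
    (is "_ \<longleftrightarrow> ?sums")
proof -
  interpret digraph G by (rule G)
  have matrix: "(let A = adjacency_mat G vs; J = all_ones_mat n; I = 1\<^sub>m n in
         A * J = int k \<cdot>\<^sub>m J \<and> J * A = int k \<cdot>\<^sub>m J \<and>
         A ^\<^sub>m 2 = int t \<cdot>\<^sub>m I + int lam \<cdot>\<^sub>m A + int \<mu> \<cdot>\<^sub>m (J - I - A)) \<longleftrightarrow> ?sums"
    if vs: "distinct vs" "set vs = verts G" for vs
  proof -
    have len: "length vs = n" using vs n distinct_card by fastforce
    have bij: "bij_betw ((!) vs) {0..<n} (verts G)"
      using bij_betw_nth[OF vs(1), of "{0..<n}" "verts G"] vs len by (simp add: atLeast0LessThan)
    have sum_nth: "(\<Sum>l\<in>{0..<n}. f (vs ! l)) = (\<Sum>v\<in>verts G. f v)" for f :: "'a \<Rightarrow> int"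
      by (rule sum.reindex_bij_betw[OF bij])
    have all_nth: "(\<forall>i<n. Q (vs ! i)) \<longleftrightarrow> (\<forall>v\<in>verts G. Q v)" for Q
      using vs len by (metis in_set_conv_nth)
    have AJ: "adjacency_mat G vs * all_ones_mat n = int k \<cdot>\<^sub>m all_ones_mat n \<longleftrightarrow>
       (\<forall>i<n. (\<Sum>v\<in>verts G. a (vs ! i) v) = int k)"
      by (auto simp: mat_eq_iff adjacency_mat_def all_ones_mat_def len scalar_prod_def a_def
          simp flip: sum_nth)
    have JA: "all_ones_mat n * adjacency_mat G vs = int k \<cdot>\<^sub>m all_ones_mat n \<longleftrightarrow>
       (\<forall>i<n. (\<Sum>v\<in>verts G. a v (vs ! i)) = int k)"
      by (auto simp: mat_eq_iff adjacency_mat_def all_ones_mat_def len scalar_prod_def a_def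
          simp flip: sum_nth)
    \<comment> \<open>Without loops the matrices I, A and J - I - A have disjoint supports, so each
      entry of the right-hand side is exactly one of t, \<open>lam\<close>, \<mu>.\<close>
    have loop: "\<not> u \<rightarrow>\<^bsub>G\<^esub> u" for u
      using no_loops by (auto simp: arcs_ends_def arc_to_ends_def)
    have sq: "(adjacency_mat G vs ^\<^sub>m 2) $$ (i, j) = (\<Sum>w\<in>verts G. a (vs ! i) w * a w (vs ! j))"
      if "i < n" "j < n" for i j
      using that by (simp add: numeral_2_eq_2 adjacency_mat_def len scalar_prod_def a_def
          flip: sum_nth)
    have rhs: "(int t \<cdot>\<^sub>m 1\<^sub>m n + int lam \<cdot>\<^sub>m adjacency_mat G vs
        + int \<mu> \<cdot>\<^sub>m (all_ones_mat n - 1\<^sub>m n - adjacency_mat G vs)) $$ (i, j) =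
       (if vs ! i = vs ! j then int t else if vs ! i \<rightarrow>\<^bsub>G\<^esub> vs ! j then int lam else int \<mu>)"
      if "i < n" "j < n" for i j
      using that loop nth_eq_iff_index_eq[OF vs(1)] len
      by (auto simp: adjacency_mat_def all_ones_mat_def)
    have dims: "dim_row (adjacency_mat G vs ^\<^sub>m 2) = n" "dim_col (adjacency_mat G vs ^\<^sub>m 2) = n"
      "dim_row (adjacency_mat G vs) = n" "dim_col (adjacency_mat G vs) = n"
      by (simp_all add: numeral_2_eq_2 adjacency_mat_def len)
    have A2: "adjacency_mat G vs ^\<^sub>m 2 = int t \<cdot>\<^sub>m 1\<^sub>m n + int lam \<cdot>\<^sub>m adjacency_mat G vs
        + int \<mu> \<cdot>\<^sub>m (all_ones_mat n - 1\<^sub>m n - adjacency_mat G vs) \<longleftrightarrow>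
       (\<forall>i<n. \<forall>j<n. (\<Sum>w\<in>verts G. a (vs ! i) w * a w (vs ! j)) =
          (if vs ! i = vs ! j then int t else if vs ! i \<rightarrow>\<^bsub>G\<^esub> vs ! j then int lam else int \<mu>))"
      unfolding mat_eq_iff using sq rhs dims by auto
    show ?thesis
      unfolding Let_def AJ JA A2
      using all_nth[of "\<lambda>u. (\<Sum>v\<in>verts G. a u v) = int k"]
        all_nth[of "\<lambda>v. (\<Sum>u\<in>verts G. a u v) = int k"]
        all_nth[of "\<lambda>u. \<forall>v\<in>verts G. (\<Sum>w\<in>verts G. a u w * a w v) =
          (if u = v then int t else if u \<rightarrow>\<^bsub>G\<^esub> v then int lam else int \<mu>)"]
        all_nth[of "\<lambda>v. (\<Sum>w\<in>verts G. a u w * a w v) =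
          (if u = v then int t else if u \<rightarrow>\<^bsub>G\<^esub> v then int lam else int \<mu>)" for u]
      by (simp only:)
  qed
  obtain vs where "distinct vs" "set vs = verts G"
    using finite_distinct_list[OF finite_verts] by blast
  then show ?thesis
    unfolding is_dsrg_def using G n matrix by blast
qed

lemma verts_Dih: "verts (Dih n X Y) = {0..<int n} \<times> UNIV"
  by (simp add: Dih_def cayley_digraph_def dihedral_group_carrier)

text \<open>With Y = X the connection set is \<open>X \<times> UNIV\<close>, so the type
  \<open>t\<close> of the target is irrelevant. The sign change for \<open>s\<close> arises because
  reflections are their own inverses.\<close>

lemma Dih_dominates_iff:
  assumes n: "n > 0" and X: "X \<subseteq> {0..<int n}"
    and u: "i \<in> {0..<int n}" and v: "j \<in> {0..<int n}"
  shows "(i, s) \<rightarrow>\<^bsub>Dih n X X\<^esub> (j, t) \<longleftrightarrow> (if s then i - j else j - i) mod int n \<in> X"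
proof -
  interpret group "dihedral_group n" by (rule group_dihedral_group[OF n])
  have inv: "inv\<^bsub>dihedral_group n\<^esub> (i, s) = (if s then i else (- i) mod int n, s)"
    by (rule inv_equality)
       (use n u in \<open>auto simp: dihedral_group_carrier dihedral_group_mult dihedral_group_one mod_simps\<close>)
  have Xmod: "i mod int n = i" if "i \<in> X" for i using that X by auto
  have S: "{dih_x n [^]\<^bsub>dihedral_group n\<^esub> i | i. i \<in> X} \<union>
      {dih_x n [^]\<^bsub>dihedral_group n\<^esub> j \<otimes>\<^bsub>dihedral_group n\<^esub> dih_a n | j. j \<in> X} = X \<times> UNIV"
    by (auto simp: dih_x_int_pow[OF n] dihedral_group_mult dih_a_def Xmod)
       (metis Xmod)+
  have "(i, s) \<rightarrow>\<^bsub>Dih n X X\<^esub> (j, t) \<longleftrightarrow>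
      inv\<^bsub>dihedral_group n\<^esub> (i, s) \<otimes>\<^bsub>dihedral_group n\<^esub> (j, t) \<in> X \<times> UNIV"
    using u v unfolding Dih_def S
    by (auto simp: cayley_digraph_def arcs_ends_def arc_to_ends_def dihedral_group_carrier image_iff)
  then show ?thesis by (simp add: inv dihedral_group_mult mod_simps)
qed

lemma digraph_Dih:
  assumes n: "n > 0" and X: "X \<subseteq> {0..<int n}" and X0: "0 \<notin> X"
  shows "digraph (Dih n X X)"
proof -
  define G where "G = Dih n X X"
  have fin: "finite (verts G)" by (simp add: G_def verts_Dih)
  have arcs: "arcs G \<subseteq> verts G \<times> verts G" "tail G = fst" "head G = snd"
    by (auto simp: G_def Dih_def cayley_digraph_def)
  have loop: "\<not> u \<rightarrow>\<^bsub>G\<^esub> u" if "u \<in> verts G" for u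
    using that Dih_dominates_iff[OF n X, of "fst u" "fst u" "snd u" "snd u"] X0
    by (auto simp: G_def verts_Dih)
  have "digraph G"
  proof
    show "tail G e \<in> verts G" "head G e \<in> verts G" if "e \<in> arcs G" for e
      using that arcs by auto
    show "finite (verts G)" by (rule fin)
    show "finite (arcs G)" using arcs(1) fin by (meson finite_SigmaI finite_subset)
    show "tail G e \<noteq> head G e" if e: "e \<in> arcs G" for e
    proof
      assume eq: "tail G e = head G e"
      have "tail G e \<rightarrow>\<^bsub>G\<^esub> head G e" using e by (auto simp: arcs_ends_def arc_to_ends_def)
      then show False using eq loop e arcs by auto
    qed
    show "e1 = e2" if "arc_to_ends G e1 = arc_to_ends G e2" for e1 e2
      using that arcs by (simp add: arc_to_ends_def prod_eq_iff)
  qed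
  then show ?thesis by (simp add: G_def)
qed

text \<open>In the group ring, \<open>S = X(1 + a)\<close> gives \<open>S\<^sup>2 = X(X + X\<^sup>-\<^sup>1)(1 + a)\<close>; comparing the
  coefficients of the rotations with those of the reflections forces \<open>t = \<mu>\<close>.\<close>

lemma is_dsrg_Dih_iff:
  fixes n :: nat and X :: "int set"
  defines "x \<equiv> \<lambda>g. if g mod int n \<in> X then 1 else 0 :: int"
  assumes n: "n > 0" and X: "X \<subseteq> {0..<int n}" and X0: "0 \<notin> X"
  shows "is_dsrg (Dih n X X) (2 * n) k \<mu> lam t \<longleftrightarrow>
    k = 2 * card X \<and> t = \<mu> \<and>
    (\<forall>g. (\<Sum>h\<in>{0..<int n}. x h * (x (g - h) + x (h - g))) = (int lam - int \<mu>) * x g + int \<mu>)"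
    (is "_ \<longleftrightarrow> _ \<and> _ \<and> ?conv")
proof -
  define G where "G = Dih n X X"
  define a where "a u v = (if u \<rightarrow>\<^bsub>G\<^esub> v then 1 else 0 :: int)" for u v
  define T where "T g = (\<Sum>h\<in>{0..<int n}. x h * (x (g - h) + x (h - g)))" for g
  have V: "verts G = {0..<int n} \<times> UNIV" by (simp add: G_def verts_Dih)
  have a: "a (i, s) (j, t) = x (if s then i - j else j - i)"
    if "i \<in> {0..<int n}" "j \<in> {0..<int n}" for i j s t
    using Dih_dominates_iff[OF n X that, of s t] by (simp add: a_def x_def G_def)
  have x_per: "x (g mod int n) = x g" for g by (simp add: x_def)
  have x_per_eq: "x g = x h" if "g mod int n = h mod int n" for g h using that by (simp add: x_def)
  have sumx: "(\<Sum>h\<in>{0..<int n}. x h) = int (card X)"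
    unfolding x_def by (rule sum_residue_indicator) (rule X)
  have shift: "(\<Sum>j\<in>{0..<int n}. x (j - i)) = int (card X)" for i
    using sum_periodic_shift[of "int n" x "- i"] n by (simp add: x_per sumx)
  have reflect: "(\<Sum>j\<in>{0..<int n}. x (i - j)) = int (card X)" for i
    using sum_periodic_reflect[of "int n" x i] n by (simp add: x_per sumx)
  have sumV: "(\<Sum>v\<in>verts G. f v) = (\<Sum>j\<in>{0..<int n}. f (j, False) + f (j, True))"
    for f :: "int \<times> bool \<Rightarrow> int"
    unfolding V by (subst sum.cartesian_product') (simp add: UNIV_bool add.commute)
  have row: "(\<Sum>v\<in>verts G. a u v) = int (2 * card X)" if mem: "u \<in> verts G" for u
  proof -
    obtain i s where u: "u = (i, s)" and i: "i \<in> {0..<int n}" using mem by (auto simp: V)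
    have "(\<Sum>v\<in>verts G. a u v) = (\<Sum>j\<in>{0..<int n}. 2 * x (if s then i - j else j - i))"
      unfolding sumV u using i by (intro sum.cong) (simp_all add: a)
    then show ?thesis by (cases s) (simp_all add: shift reflect flip: sum_distrib_left)
  qed
  have col: "(\<Sum>u\<in>verts G. a u v) = int (2 * card X)" if mem: "v \<in> verts G" for v
  proof -
    obtain j t where v: "v = (j, t)" and j: "j \<in> {0..<int n}" using mem by (auto simp: V)
    have "(\<Sum>u\<in>verts G. a u v) = (\<Sum>i\<in>{0..<int n}. x (j - i) + x (i - j))"
      unfolding sumV v using j by (intro sum.cong) (simp_all add: a)
    then show ?thesis by (simp add: sum.distrib shift reflect)
  qed
  \<comment> \<open>The intermediate vertices (l, False) and (l, True) are entered with equal weight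
    and left with weights x(j - l) and x(l - j). Measuring l from i, reversed when \<open>s\<close>
    holds, leaves a sum depending only on the difference.\<close>
  have square: "(\<Sum>w\<in>verts G. a (i, s) w * a w (j, t)) = T (if s then i - j else j - i)"
    if ij: "i \<in> {0..<int n}" "j \<in> {0..<int n}" for i j s t
  proof -
    define d where "d = (if s then i - j else j - i)"
    define f where "f h = x h * (x (d - h) + x (h - d))" for h
    have fper: "f (h mod int n) = f h" for h
      unfolding f_def
      by (auto simp: x_per mod_simps intro!: arg_cong2[where f = "(*)"] arg_cong2[where f = "(+)"] x_per_eq)
    have "(\<Sum>w\<in>verts G. a (i, s) w * a w (j, t))
        = (\<Sum>l\<in>{0..<int n}. x (if s then i - l else l - i) * (x (j - l) + x (l - j)))"
      unfolding sumV using ij by (intro sum.cong) (auto simp: a algebra_simps)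
    also have "\<dots> = (\<Sum>l\<in>{0..<int n}. f (if s then i - l else l + - i))"
      by (intro sum.cong) (auto simp: f_def d_def algebra_simps)
    also have "\<dots> = (\<Sum>l\<in>{0..<int n}. f l)"
      using n sum_periodic_shift[of "int n" f "- i"] sum_periodic_reflect[of "int n" f i] fper
      by (cases s) auto
    finally show ?thesis by (simp add: f_def d_def T_def)
  qed
  have T_per: "T (g mod int n) = T g" for g
    unfolding T_def
    by (auto simp: mod_simps intro!: sum.cong arg_cong2[where f = "(*)"] arg_cong2[where f = "(+)"] x_per_eq)
  have x0: "x 0 = 0" using X0 by (simp add: x_def)
  have dom: "u \<rightarrow>\<^bsub>G\<^esub> v \<longleftrightarrow> a u v = 1" for u v by (simp add: a_def)
  have x01: "x g = 0 \<or> x g = 1" for g by (simp add: x_def)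
  have ne: "(0, True) \<in> verts G" "(0, False) \<in> verts G" using n by (auto simp: V)
  have dg: "digraph G" using digraph_Dih[OF n X X0] by (simp add: G_def)
  have cardV: "card (verts G) = 2 * n" by (simp add: V card_cartesian_product)
  have "is_dsrg G (2 * n) k \<mu> lam t \<longleftrightarrow> k = 2 * card X \<and>
    (\<forall>u\<in>verts G. \<forall>v\<in>verts G. (\<Sum>w\<in>verts G. a u w * a w v) =
       (if u = v then int t else if u \<rightarrow>\<^bsub>G\<^esub> v then int lam else int \<mu>))" (is "_ \<longleftrightarrow> _ \<and> ?sq")
    unfolding is_dsrg_iff_sums[OF dg cardV] a_def[symmetric] using row col ne by auto
  also have "?sq \<longleftrightarrow> t = \<mu> \<and> ?conv"
  proof
    assume sq: ?sq
    \<comment> \<open>The target is a reflection and the source a rotation, so they differ even for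
      g = 0. Hence T 0 = \<mu>, whereas the diagonal entry gives T 0 = t.\<close>
    have T: "T g = (int lam - int \<mu>) * x g + int \<mu>" for g
    proof -
      have in_range: "g mod int n \<in> {0..<int n}" "0 \<in> {0..<int n}" using n by auto
      have "T g = (\<Sum>w\<in>verts G. a (0, False) w * a w (g mod int n, True))"
        using square[OF in_range(2,1), of False True] by (simp add: T_per)
      also have "\<dots> = (if (0, False) \<rightarrow>\<^bsub>G\<^esub> (g mod int n, True) then int lam else int \<mu>)"
        using sq in_range by (auto simp: V)
      also have "\<dots> = (int lam - int \<mu>) * x g + int \<mu>"
        unfolding dom using a[OF in_range(2,1), of False True] x01[of g] by (auto simp: x_per)
      finally show ?thesis .
    qed
    have "int t = T 0"
      using sq ne square[of 0 0 False False] n by auto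
    also have "\<dots> = int \<mu>" by (simp add: T x0)
    finally have "t = \<mu>" by simp
    then show "t = \<mu> \<and> ?conv" using T by (simp add: T_def)
  next
    assume "t = \<mu> \<and> ?conv"
    then have t: "t = \<mu>" and conv: "T g = (int lam - int \<mu>) * x g + int \<mu>" for g
      by (auto simp: T_def)
    show ?sq
    proof (intro ballI)
      fix u v assume uv: "u \<in> verts G" "v \<in> verts G"
      obtain i s j r where u: "u = (i, s)" and v: "v = (j, r)" by (metis surj_pair)
      have ij: "i \<in> {0..<int n}" "j \<in> {0..<int n}" using uv by (auto simp: u v V)
      have "(\<Sum>w\<in>verts G. a u w * a w v) = (int lam - int \<mu>) * a u v + int \<mu>"
        unfolding u v square[OF ij] a[OF ij] by (rule conv)
      moreover have "a u v = 0" if "u = v" using that ij by (auto simp: u v a x0)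
      ultimately show "(\<Sum>w\<in>verts G. a u w * a w v)
          = (if u = v then int t else if u \<rightarrow>\<^bsub>G\<^esub> v then int lam else int \<mu>)"
        using t by (auto simp: a_def)
    qed
  qed
  finally show ?thesis by (simp add: G_def)
qed

subsection \<open>The classification\<close>

lemma neg_set_residues:
  assumes "m > 1"
  shows "neg_set m H = (\<lambda>h. (- h) mod int m) ` H"
proof -
  interpret residues "int m" "residue_ring (int m)"
    using assms by unfold_locales auto
  show ?thesis by (auto simp: neg_set_def res_neg_eq)
qed

text \<open>Periodicity of the indicator modulo p^\<gamma> expresses that X is a full preimage; the
  identity for x(g) + x(-g) expresses that H and -H partition the nonzero residues.\<close>

lemma psi_preimage_skew_iff:
  fixes p \<alpha> \<gamma> :: nat and X :: "int set"
  defines "x \<equiv> \<lambda>g. if g mod int (p ^ \<alpha>) \<in> X then 1 else 0 :: int"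
  assumes p: "p > 1" and \<gamma>: "1 \<le> \<gamma>" "\<gamma> \<le> \<alpha>" and X: "X \<subseteq> {0..<int (p ^ \<alpha>)} - {0}"
  shows "(\<exists>H \<subseteq> carrier (residue_ring (int (p ^ \<gamma>))). X = psi_preimage p \<alpha> \<gamma> H \<and>
       H \<union> neg_set (p ^ \<gamma>) H = carrier (residue_ring (int (p ^ \<gamma>))) - {0} \<and>
       H \<inter> neg_set (p ^ \<gamma>) H = {}) \<longleftrightarrow>
    (\<forall>g. x (g mod int (p ^ \<gamma>)) = x g) \<and>
    (\<forall>g. x g + x (- g) = (if int (p ^ \<gamma>) dvd g then 0 else 1))" (is "?L \<longleftrightarrow> ?R")
proof -
  define n where "n = int (p ^ \<alpha>)"
  define N where "N = int (p ^ \<gamma>)"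
  have N1: "p ^ \<gamma> > 1" using p \<gamma>(1) by (intro one_less_power) auto
  have N0: "N > 0" using p by (simp add: N_def)
  have "N dvd n" using \<gamma>(2) by (simp add: N_def n_def le_imp_power_dvd)
  have n0: "n > 0" using p by (simp add: n_def)
  have "N \<le> n" using zdvd_imp_le[OF \<open>N dvd n\<close> n0] .
  have mod_mod: "g mod n mod N = g mod N" for g
    using \<open>N dvd n\<close> by (simp add: mod_mod_cancel)
  have X': "X \<subseteq> {0..<n}" "0 \<notin> X" using X by (auto simp: n_def)
  have x_def': "x = (\<lambda>g. if g mod n \<in> X then 1 else 0)" by (simp add: x_def n_def)
  have carrier: "carrier (residue_ring (int m)) = {0..<int m}" for m
    by (auto simp: residue_ring_def)
  have L_iff: "?L \<longleftrightarrow> (\<exists>H \<subseteq> {0..<N}. X = {i \<in> {0..<n}. i mod N \<in> H} \<and>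
      H \<union> (\<lambda>h. (- h) mod N) ` H = {0..<N} - {0} \<and> H \<inter> (\<lambda>h. (- h) mod N) ` H = {})"
    unfolding neg_set_residues[OF N1] psi_preimage_def psi_def carrier n_def N_def by simp
  show ?thesis
  proof
    assume ?L
    then obtain H where H: "H \<subseteq> {0..<N}" "X = {i \<in> {0..<n}. i mod N \<in> H}"
      and un: "H \<union> (\<lambda>h. (- h) mod N) ` H = {0..<N} - {0}"
      and dis: "H \<inter> (\<lambda>h. (- h) mod N) ` H = {}"
      unfolding L_iff by blast
    have xH: "x g = (if g mod N \<in> H then 1 else 0)" for g
      using n0 by (simp add: x_def' H(2) mod_mod)
    have neg_iff: "(- g) mod N \<in> H \<longleftrightarrow> g mod N \<in> (\<lambda>h. (- h) mod N) ` H" for g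
    proof
      assume "(- g) mod N \<in> H"
      then show "g mod N \<in> (\<lambda>h. (- h) mod N) ` H"
        by (rule rev_image_eqI) (simp add: mod_minus_eq)
    next
      assume "g mod N \<in> (\<lambda>h. (- h) mod N) ` H"
      then obtain h where h: "h \<in> H" "g mod N = (- h) mod N" by blast
      then have "(- g) mod N = h mod N" by (metis add.inverse_inverse mod_minus_cong)
      then show "(- g) mod N \<in> H" using h(1) H(1) by auto
    qed
    have "x g + x (- g) = (if N dvd g then 0 else 1)" for g
    proof (cases "N dvd g")
      case True
      then have "g mod N = 0" "(- g) mod N = 0" by simp_all
      moreover have "0 \<notin> H" using un by blast
      ultimately show ?thesis using True by (simp add: xH)
    next
      case False
      then have "g mod N \<in> {0..<N} - {0}" using N0 by (simp add: dvd_eq_mod_eq_0)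
      then have "g mod N \<in> H \<union> (\<lambda>h. (- h) mod N) ` H" unfolding un .
      then show ?thesis using False dis neg_iff[of g] by (auto simp: xH)
    qed
    then show ?R unfolding N_def[symmetric] by (simp add: xH)
  next
    assume R: ?R
    have xN: "x (g mod N) = x g" and sk: "x g + x (- g) = (if N dvd g then 0 else 1)" for g
      using R by (auto simp: N_def)
    \<comment> \<open>Residues below \<open>N\<close> are fixed by the reduction, so this is the
      only possible H.\<close>
    define H where "H = X \<inter> {0..<N}"
    have xH: "x g = 1 \<longleftrightarrow> g mod N \<in> H" for g
    proof -
      have "g mod N mod n = g mod N" using N0 \<open>N \<le> n\<close>
        by (intro mod_pos_pos_trivial) (auto intro: less_le_trans[OF pos_mod_bound])
      then show ?thesis using xN[of g] N0 by (auto simp: x_def' H_def split: if_splits)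
    qed
    have x01: "x g = 0 \<or> x g = 1" for g by (simp add: x_def)
    have HN: "H \<subseteq> {0..<N}" by (simp add: H_def)
    have Hx: "x h = 1" if "h \<in> H" for h using that HN xH[of h] by auto
    have H0: "0 \<notin> H" using X' by (simp add: H_def)
    have "X = {i \<in> {0..<n}. i mod N \<in> H}"
    proof -
      have "i \<in> X \<longleftrightarrow> x i = 1" if "i \<in> {0..<n}" for i using that by (auto simp: x_def')
      then show ?thesis using X'(1) xH by blast
    qed
    moreover have "H \<union> (\<lambda>h. (- h) mod N) ` H = {0..<N} - {0}"
    proof (intro equalityI subsetI)
      fix g assume "g \<in> H \<union> (\<lambda>h. (- h) mod N) ` H"
      moreover have "\<not> N dvd h" if "h \<in> H" for h
      proof
        assume "N dvd h"
        then show False using sk[of h] Hx[OF that] x01[of "- h"] by auto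
      qed
      ultimately show "g \<in> {0..<N} - {0}" using HN H0 N0 by auto
    next
      fix g assume g: "g \<in> {0..<N} - {0}"
      then have "\<not> N dvd g" by (auto dest: zdvd_imp_le)
      then have "x g = 1 \<or> x (- g) = 1" using sk[of g] x01[of g] by auto
      then show "g \<in> H \<union> (\<lambda>h. (- h) mod N) ` H"
      proof
        assume "x g = 1"
        then show ?thesis using xH[of g] g by simp
      next
        assume "x (- g) = 1"
        then have "(- g) mod N \<in> H" by (simp add: xH)
        moreover have "g = (- ((- g) mod N)) mod N" using g by (simp add: mod_minus_eq)
        ultimately show ?thesis by blast
      qed
    qed
    moreover have "H \<inter> (\<lambda>h. (- h) mod N) ` H = {}"
    proof (rule ccontr)
      assume "H \<inter> (\<lambda>h. (- h) mod N) ` H \<noteq> {}"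
      then obtain h where h: "h \<in> H" "(- h) mod N \<in> H" by blast
      then have "x h = 1" "x (- h) = 1" using Hx xH by auto
      then show False using sk[of h] by (auto split: if_splits)
    qed
    ultimately show ?L unfolding L_iff using HN by blast
  qed
qed

lemma sum_coset_indicator:
  fixes N r :: int
  assumes "N > 0" "r > 0"
  shows "(\<Sum>h\<in>{0..<N * r}. if N dvd g - h then k else 0) = r * (k :: int)"
proof -
  have "(\<Sum>h\<in>{0..<N * r}. if N dvd g - h then k else 0)
      = (\<Sum>h\<in>{0..<N * r}. if N dvd h then k else 0)"
    using assms by (intro sum_periodic_reflect[where f = "\<lambda>h. if N dvd h then k else 0"])
      (simp_all add: dvd_mod_iff)
  then show ?thesis using assms by (simp add: sum_multiples_indicator)
qed

theorem theorem6p1: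
  fixes p \<alpha> :: nat and X :: "int set"
  assumes "prime p" and "odd p" and "\<alpha> \<ge> 1"
    and "X \<subseteq> carrier (residue_ring (int (p ^ \<alpha>))) - {0}"
  shows "genuine_dsrg (Dih (p ^ \<alpha>) X X) \<longleftrightarrow>
    (\<exists>\<gamma> H. 1 \<le> \<gamma> \<and> \<gamma> \<le> \<alpha> \<and> H \<subseteq> carrier (residue_ring (int (p ^ \<gamma>))) \<and>
       X = psi_preimage p \<alpha> \<gamma> H \<and>
       H \<union> neg_set (p ^ \<gamma>) H = carrier (residue_ring (int (p ^ \<gamma>))) - {0} \<and>
       H \<inter> neg_set (p ^ \<gamma>) H = {})"
proof -
  define n where "n = p ^ \<alpha>"
  define x where "x g = (if g mod int n \<in> X then 1 else 0 :: int)" for g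
  define Y where "Y g = x g + x (- g)" for g
  have p1: "p > 1" using assms(1) prime_gt_1_nat by blast
  have p3: "p \<ge> 3" using assms(2) p1 by (cases "p = 2") auto
  have n: "n > 0" using p1 by (simp add: n_def)
  have Xn: "X \<subseteq> {0..<int n} - {0}" using assms(4) by (auto simp: n_def residue_ring_def)
  then have X: "X \<subseteq> {0..<int n}" "0 \<notin> X" by auto
  have x_per: "x (g mod int n) = x g" for g by (simp add: x_def)
  have x_per_neg: "x (- (g mod int n)) = x (- g)" for g by (simp add: x_def mod_minus_eq)
  have x01: "x g = 0 \<or> x g = 1" for g by (simp add: x_def)
  have Y_even: "Y (- g) = Y g" for g by (simp add: Y_def)
  have Y_per: "Y (g mod int n) = Y g" for g by (simp add: Y_def x_per x_per_neg)
  have sumx: "(\<Sum>h\<in>{0..<int n}. x h) = int (card X)"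
    unfolding x_def by (rule sum_residue_indicator) (rule X(1))
  have reflect: "(\<Sum>h\<in>{0..<int n}. f (- h)) = (\<Sum>h\<in>{0..<int n}. f h)"
    if "\<And>h. f (h mod int n) = f h" for f :: "int \<Rightarrow> int"
    using sum_periodic_reflect[of "int n" f 0] n that by simp
  have dsrg: "is_dsrg (Dih n X X) (2 * n) k \<mu> lam t \<longleftrightarrow> k = 2 * card X \<and> t = \<mu> \<and>
    (\<forall>g. (\<Sum>h\<in>{0..<int n}. x h * Y (g - h)) = (int lam - int \<mu>) * x g + int \<mu>)" for k \<mu> lam t
    using is_dsrg_Dih_iff[OF n X] unfolding x_def[symmetric] Y_def by simp
  have card_verts: "card (verts (Dih n X X)) = 2 * n"
    by (simp add: verts_Dih card_cartesian_product)
  \<comment> \<open>In the group ring Y is C minus the subgroup of \<open>N\<close>, so X Y is the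
    constant |X| minus the number of elements of X in the coset of g.\<close>
  have split: "(\<Sum>h\<in>{0..<int n}. x h * Y (g - h))
      = int (card X) - (\<Sum>h\<in>{0..<int n}. if N dvd g - h then x h else 0)"
    if "\<And>g. Y g = (if N dvd g then 0 else 1)" for N g
    unfolding sumx[symmetric] sum_subtractf[symmetric] by (intro sum.cong) (auto simp: that)
  have "genuine_dsrg (Dih n X X) \<longleftrightarrow> (\<exists>\<gamma>. 1 \<le> \<gamma> \<and> \<gamma> \<le> \<alpha> \<and> (\<forall>g. x (g mod int (p ^ \<gamma>)) = x g) \<and>
      (\<forall>g. Y g = (if int (p ^ \<gamma>) dvd g then 0 else 1)))" (is "_ \<longleftrightarrow> ?R")
  proof
    assume "genuine_dsrg (Dih n X X)"
    then obtain k \<mu> lam t where d: "is_dsrg (Dih n X X) (2 * n) k \<mu> lam t" and t: "0 < t" "t < k"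
      unfolding genuine_dsrg_def using card_verts by (metis is_dsrg_def)
    define c where "c = int lam - int \<mu>"
    have k: "k = 2 * card X" and "t = \<mu>"
      and conv: "(\<Sum>h\<in>{0..<int n}. x h * Y (g - h)) = c * x g + int \<mu>" for g
      using d unfolding dsrg c_def by auto
    \<comment> \<open>Inverting the group elements in \<open>conv\<close> and using that Y is even
      gives the same equation for x(-h); the sum of the two is the claim.\<close>
    have Yconv: "(\<Sum>h\<in>{0..<int n}. Y h * Y (g - h)) = c * Y g + 2 * int \<mu>" for g
    proof -
      have "(\<Sum>h\<in>{0..<int n}. x (- h) * Y (g - h)) = (\<Sum>h\<in>{0..<int n}. x h * Y (- g - h))"
      proof -
        define f where "f h = x h * Y (- g - h)" for h
        have f_per: "f (h mod int n) = f h" for h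
          unfolding f_def x_per by (metis Y_per mod_diff_right_eq)
        have "x (- h) * Y (g - h) = f (- h)" for h
          using Y_even[of "g - h"] by (simp add: f_def)
        then have "(\<Sum>h\<in>{0..<int n}. x (- h) * Y (g - h)) = (\<Sum>h\<in>{0..<int n}. f (- h))"
          by (intro sum.cong refl)
        also have "\<dots> = (\<Sum>h\<in>{0..<int n}. f h)" by (rule reflect) (rule f_per)
        finally show ?thesis unfolding f_def .
      qed
      then have "(\<Sum>h\<in>{0..<int n}. x (- h) * Y (g - h)) = c * x (- g) + int \<mu>"
        unfolding conv .
      then show ?thesis
        unfolding Y_def[of g] using conv[of g]
        by (subst Y_def) (simp add: distrib_right distrib_left sum.distrib)
    qed
    obtain g0 where "g0 \<in> X" using t k by (metis card.empty ex_in_conv mult_0_right not_less0)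
    then have "x g0 = 1" using X by (auto simp: x_def)
    then have nz: "Y g0 \<noteq> 0" using x01[of "- g0"] by (auto simp: Y_def)
    have Y0: "Y 0 = 0" using X by (simp add: Y_def x_def)
    have val: "Y g \<in> {0, 1, 2}" for g using x01[of g] x01[of "- g"] by (auto simp: Y_def)
    obtain \<gamma> y where \<gamma>: "1 \<le> \<gamma>" "\<gamma> \<le> \<alpha>" and y: "y \<in> {1, 2}"
      and c: "c = - y * int (p ^ (\<alpha> - \<gamma>))"
      and Yg: "\<And>g. Y g = (if int (p ^ \<gamma>) dvd g then 0 else y)"
      using prime_power_convolution_two_valued[OF assms(1,2) Y_per[unfolded n_def] Y_even Y0 val nz
          Yconv[unfolded n_def]] by blast
    \<comment> \<open>The value 2 would force X = -X, and the equation at 0 would read \<mu> = 2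
      |X|, that is t = k.\<close>
    have "y \<noteq> 2"
    proof
      assume "y = 2"
      have "x h * Y (0 - h) = 2 * x h" for h
        using Yg[of h] \<open>y = 2\<close> x01[of h] x01[of "- h"] Y_even[of h] by (auto simp: Y_def split: if_splits)
      then have "(\<Sum>h\<in>{0..<int n}. x h * Y (0 - h)) = 2 * int (card X)"
        by (simp only: sumx flip: sum_distrib_left)
      then have "2 * int (card X) = int \<mu>"
        using conv[of 0] X by (simp add: x_def[of 0])
      then show False using t k \<open>t = \<mu>\<close> by linarith
    qed
    then have y: "y = 1" using y by simp
    define N where "N = int (p ^ \<gamma>)"
    define r where "r = int (p ^ (\<alpha> - \<gamma>))"
    have r: "r > 0" using p1 by (simp add: r_def)
    have Y1: "Y g = (if N dvd g then 0 else 1)" for g using Yg y by (simp add: N_def)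
    \<comment> \<open>The convolution equation now expresses r x(g) as a coset count plus a
      constant. The count depends only on g modulo \<open>N\<close>, hence so does x.\<close>
    define Q where "Q g = (\<Sum>h\<in>{0..<int n}. if N dvd g - h then x h else 0)" for g
    have "r * x g = Q g + int \<mu> - int (card X)" for g
      using conv[of g] split[OF Y1, of g] c y by (simp add: Q_def r_def)
    moreover have "Q (g mod N) = Q g" for g
    proof -
      have "N dvd g mod N - h \<longleftrightarrow> N dvd g - h" for h
        by (metis mod_diff_left_eq mod_0_imp_dvd dvd_imp_mod_0)
      then show ?thesis by (simp add: Q_def)
    qed
    ultimately have "r * x (g mod N) = r * x g" for g by simp
    then have "x (g mod N) = x g" for g using r by simp
    then show ?R using \<gamma> Y1 unfolding N_def by blast
  next
    assume ?R
    then obtain \<gamma> where \<gamma>: "1 \<le> \<gamma>" "\<gamma> \<le> \<alpha>" and xN: "\<And>g. x (g mod int (p ^ \<gamma>)) = x g"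
      and Y1: "\<And>g. Y g = (if int (p ^ \<gamma>) dvd g then 0 else 1)" by blast
    define N where "N = int (p ^ \<gamma>)"
    define r where "r = int (p ^ (\<alpha> - \<gamma>))"
    have nN: "int n = N * r" using \<gamma>(2) by (simp add: n_def N_def r_def flip: power_add)
    have pos: "N > 0" "r > 0" using p1 by (simp_all add: N_def r_def)
    have "p ^ 1 \<le> p ^ \<gamma>" using \<gamma>(1) p1 by (intro power_increasing) auto
    then have "3 \<le> p ^ \<gamma>" using p3 by simp
    then have "int 3 \<le> int (p ^ \<gamma>)" by (simp only: of_nat_le_iff)
    then have N3: "N \<ge> 3" by (simp add: N_def)
    have conv: "(\<Sum>h\<in>{0..<int n}. x h * Y (g - h)) = int (card X) - r * x g" for g
    proof -
      have "(if N dvd g - h then x h else 0) = (if N dvd g - h then x g else 0)" for h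
        using xN[of g] xN[of h] by (auto simp: N_def mod_eq_dvd_iff[symmetric])
      then have "(\<Sum>h\<in>{0..<int n}. if N dvd g - h then x h else 0) = r * x g"
        using sum_coset_indicator[OF pos, of g "x g"] by (simp add: nN)
      then show ?thesis using split[of N g] Y1 by (simp add: N_def)
    qed
    have "(\<Sum>h\<in>{0..<int n}. Y h) = 2 * int (card X)"
      using reflect[of x] by (simp add: Y_def sum.distrib sumx x_per)
    moreover have "(\<Sum>h\<in>{0..<int n}. Y h) = int n - r"
    proof -
      have "Y h = 1 - (if N dvd h then 1 else 0)" for h using Y1 by (simp add: N_def)
      then have "(\<Sum>h\<in>{0..<int n}. Y h) = int n - (\<Sum>h\<in>{0..<N * r}. if N dvd h then 1 else 0)"
        using pos by (simp add: sum_subtractf nN)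
      then show ?thesis using pos by (simp add: sum_multiples_indicator)
    qed
    ultimately have "2 * int (card X) = (N - 1) * r" by (simp add: nN algebra_simps)
    \<comment> \<open>This bound yields r <= |X|, so the natural-number difference used for
      \<open>lam\<close> is not truncated and \<open>lam\<close> - \<mu> = -r.\<close>
    moreover have "2 * r \<le> (N - 1) * r" using N3 pos by (intro mult_right_mono) auto
    ultimately have rX: "r \<le> int (card X)" by linarith
    then have "int (card X - p ^ (\<alpha> - \<gamma>)) - int (card X) = - r" by (simp add: r_def of_nat_diff)
    then have "is_dsrg (Dih n X X) (2 * n) (2 * card X) (card X) (card X - p ^ (\<alpha> - \<gamma>)) (card X)"
      unfolding dsrg conv by simp
    moreover have "0 < card X" using rX pos by linarith
    ultimately show "genuine_dsrg (Dih n X X)"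
      unfolding genuine_dsrg_def by (metis mult_2 less_add_same_cancel1)
  qed
  also have "\<dots> \<longleftrightarrow> (\<exists>\<gamma>. 1 \<le> \<gamma> \<and> \<gamma> \<le> \<alpha> \<and> (\<exists>H \<subseteq> carrier (residue_ring (int (p ^ \<gamma>))).
       X = psi_preimage p \<alpha> \<gamma> H \<and>
       H \<union> neg_set (p ^ \<gamma>) H = carrier (residue_ring (int (p ^ \<gamma>))) - {0} \<and>
       H \<inter> neg_set (p ^ \<gamma>) H = {}))"
    using psi_preimage_skew_iff[OF p1 _ _ Xn[unfolded n_def]]
    unfolding Y_def x_def n_def by (intro ex_cong1 conj_cong refl) simp
  finally show ?thesis unfolding n_def by blast
qed

end
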